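(* Let $\Lambda$ be a ring. In the (possibly large) category of additive covariant functors from $\Lambda$-modules to abelian groups, let $\mathscr{T}$ be the class of injectively stable functors and let $\mathscr{F}$ be the class of functors that preserve monomorphisms. Then $(\mathscr{T},\mathscr{F})$ is a hereditary torsion theory.
   Context: Exactness, subfunctors, kernels, images, etc. are understood componentwise. Injective stabilization: for an additive functor $F$ and a module $B$ choose an exact sequence $0 \to B \overset{\iota}{\to} I^0 \overset{\partial}{\to} I^1$ with $I^0, I^1$ injective. Then $R^0F(B) = \ker F(\partial)$, the map $F(\iota)$ induces a natural transformation $\rho_F : F \to R^0F$, and $\overline{F} := \ker \rho_F$. $F$ is injectively stable if the inclusion $\overline{F} \to F$ is an isomorphism (equivalently, $F$ vanishes on all injective modules). A pair $(\mathscr{T},\mathscr{F})$ of classes of objects is a torsion theory if every morphism from an object of $\mathscr{T}$ to an object of $\mathscr{F}$ is zero and every object $X$ fits in a short exact sequence $0 \to T \to X \to Y \to 0$ with $T \in \mathscr{T}$ and $Y \in \mathscr{F}$ (both classes being closed under isomorphism). It is hereditary if $\mathscr{T}$ is closed under subobjects. *)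

theory Defs
  imports
    "HOL-Algebra.Module"
    "HOL-Algebra.Exact_Sequence"
    "HOL-Library.Equipollence"
begin

section \<open>Modules over a ring that need not be commutative\<close>

text \<open>
  The library locale \<^locale>\<open>module\<close> requires a commutative ring of scalars. The following locale has the
  same axioms over an arbitrary unital ring, and reuses the library record. Right modules are left
  modules over the opposite ring. The fields \<^term>\<open>mult\<close> and \<^term>\<open>one\<close> that the record
  inherits play no role.
\<close>

locale left_module = R: ring R + M: abelian_group M for R (structure) and M (structure) +
  assumes smult_closed:
      "\<lbrakk>a \<in> carrier R; x \<in> carrier M\<rbrakk> \<Longrightarrow> a \<odot>\<^bsub>M\<^esub> x \<in> carrier M"
    and smult_l_distr:
      "\<lbrakk>a \<in> carrier R; b \<in> carrier R; x \<in> carrier M\<rbrakk> \<Longrightarrow>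
        (a \<oplus>\<^bsub>R\<^esub> b) \<odot>\<^bsub>M\<^esub> x = a \<odot>\<^bsub>M\<^esub> x \<oplus>\<^bsub>M\<^esub> b \<odot>\<^bsub>M\<^esub> x"
    and smult_r_distr:
      "\<lbrakk>a \<in> carrier R; x \<in> carrier M; y \<in> carrier M\<rbrakk> \<Longrightarrow>
        a \<odot>\<^bsub>M\<^esub> (x \<oplus>\<^bsub>M\<^esub> y) = a \<odot>\<^bsub>M\<^esub> x \<oplus>\<^bsub>M\<^esub> a \<odot>\<^bsub>M\<^esub> y"
    and smult_assoc1:
      "\<lbrakk>a \<in> carrier R; b \<in> carrier R; x \<in> carrier M\<rbrakk> \<Longrightarrow>
        (a \<otimes>\<^bsub>R\<^esub> b) \<odot>\<^bsub>M\<^esub> x = a \<odot>\<^bsub>M\<^esub> (b \<odot>\<^bsub>M\<^esub> x)"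
    and smult_one:
      "x \<in> carrier M \<Longrightarrow> \<one>\<^bsub>R\<^esub> \<odot>\<^bsub>M\<^esub> x = x"

lemma left_module_iff_module: "cring R \<Longrightarrow> left_module R M \<longleftrightarrow> module R M"
  by (auto simp: left_module_def left_module_axioms_def module_def module_axioms_def cring_def)

text \<open>
  Homomorphisms are taken extensional, so that equality of morphisms is equality in HOL. The
  composite of \<^term>\<open>f\<close> and \<^term>\<open>g\<close> is \<^term>\<open>compose (carrier M) g f\<close>.
\<close>

definition mod_hom ::
  "('r, 'q) ring_scheme \<Rightarrow> ('r, 'u) module \<Rightarrow> ('r, 'u) module \<Rightarrow> ('u \<Rightarrow> 'u) set" where
  "mod_hom R M N = {f \<in> carrier M \<rightarrow>\<^sub>E carrier N.
     (\<forall>x\<in>carrier M. \<forall>y\<in>carrier M. f (x \<oplus>\<^bsub>M\<^esub> y) = f x \<oplus>\<^bsub>N\<^esub> f y) \<and>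
     (\<forall>a\<in>carrier R. \<forall>x\<in>carrier M. f (a \<odot>\<^bsub>M\<^esub> x) = a \<odot>\<^bsub>N\<^esub> f x)}"

definition mod_mono ::
  "('r, 'q) ring_scheme \<Rightarrow> ('r, 'u) module \<Rightarrow> ('r, 'u) module \<Rightarrow> ('u \<Rightarrow> 'u) set" where
  "mod_mono R M N = {f \<in> mod_hom R M N. inj_on f (carrier M)}"


section \<open>Sizes\<close>

text \<open>
  There is no type of all modules. The modules considered have their carrier in a collection
  \<open>U\<close> of subsets of a type, playing the part of the small sets. Such a \<open>U\<close> has to be closed under
  passing to sets that are no larger. For \<open>R\<close>-modules it also has to contain an infinite
  set and, up to bijection, the set of functions from \<open>R\<close> to any of its members; this is what the
  existence of enough injectives requires. Two instances: the sets of cardinality below an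
  inaccessible cardinal that exceeds the cardinality of \<open>R\<close> (a Grothendieck universe), and
  all subsets of a suitable type, see \<open>module_universe_UNIV\<close>. Likewise \<open>V\<close> bounds the
  carriers of the abelian groups in which functors take values; nothing beyond closure under
  no larger sets is needed there.
\<close>

definition size_closed :: "'u set set \<Rightarrow> bool" where
  "size_closed U \<longleftrightarrow> (\<forall>A\<in>U. \<forall>B :: 'u set. B \<lesssim> A \<longrightarrow> B \<in> U)"

definition module_universe :: "('r, 'q) ring_scheme \<Rightarrow> 'u set set \<Rightarrow> bool" where
  "module_universe R U \<longleftrightarrow>
     size_closed U \<and>
     (\<exists>A\<in>U. infinite A) \<and>
     (\<forall>A\<in>U. \<exists>B\<in>U. (carrier R \<rightarrow>\<^sub>E A) \<lesssim> B)"

lemma module_universe_UNIV: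
  fixes R :: "('r, 'q) ring_scheme"
  shows "module_universe R (UNIV :: ('r list \<times> 'w) set set set)"
proof -
  let ?V = "UNIV :: ('r list \<times> 'w) set set"
  have "infinite (UNIV :: ('r list \<times> 'w) set)"
    by (simp add: finite_prod infinite_UNIV_listI)
  then have inf: "infinite ?V"
    by (simp add: Finite_Set.finite_set)
  have "(carrier R \<rightarrow>\<^sub>E A) \<lesssim> ?V" for A :: "('r list \<times> 'w) set set"
  proof -
    let ?code = "\<lambda>f :: 'r \<Rightarrow> ('r list \<times> 'w) set. {(r # rs, w) | r rs w. (rs, w) \<in> f r}"
    have "inj ?code"
    proof (rule injI)
      fix f g :: "'r \<Rightarrow> ('r list \<times> 'w) set"
      assume eq: "?code f = ?code g"
      have "(rs, w) \<in> f r \<longleftrightarrow> (rs, w) \<in> g r" for r rs w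
      proof -
        have "(rs, w) \<in> f r \<longleftrightarrow> (r # rs, w) \<in> ?code f" by blast
        also have "\<dots> \<longleftrightarrow> (r # rs, w) \<in> ?code g" using eq by simp
        also have "\<dots> \<longleftrightarrow> (rs, w) \<in> g r" by blast
        finally show ?thesis .
      qed
      then show "f = g" by (auto simp: fun_eq_iff set_eq_iff)
    qed
    then show ?thesis
      unfolding lepoll_def by (meson inj_on_subset subset_UNIV)
  qed
  with inf show ?thesis
    unfolding module_universe_def size_closed_def by blast
qed

definition modules_in :: "('r, 'q) ring_scheme \<Rightarrow> 'u set set \<Rightarrow> ('r, 'u) module set" where
  "modules_in R U = {M. left_module R M \<and> carrier M \<in> U}"


section \<open>The category of additive functors\<close>

text \<open>
  Abelian groups are written multiplicatively, following \<^locale>\<open>comm_group\<close>.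
  Homomorphisms of abelian groups matter only on their source, so equality of such
  homomorphisms is always stated pointwise on the carrier.
\<close>

record ('r, 'u, 'v) mod_functor =
  fob :: "('r, 'u) module \<Rightarrow> 'v monoid"
  fmap :: "('r, 'u) module \<Rightarrow> ('r, 'u) module \<Rightarrow> ('u \<Rightarrow> 'u) \<Rightarrow> 'v \<Rightarrow> 'v"

definition additive_functors ::
  "('r, 'q) ring_scheme \<Rightarrow> 'u set set \<Rightarrow> 'v set set \<Rightarrow> ('r, 'u, 'v) mod_functor set" where
  "additive_functors R U V = {F.
     (\<forall>M\<in>modules_in R U. comm_group (fob F M) \<and> carrier (fob F M) \<in> V) \<and>
     (\<forall>M\<in>modules_in R U. \<forall>N\<in>modules_in R U. \<forall>f\<in>mod_hom R M N.
        fmap F M N f \<in> hom (fob F M) (fob F N)) \<and>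
     (\<forall>M\<in>modules_in R U. \<forall>x\<in>carrier (fob F M). fmap F M M (\<lambda>m\<in>carrier M. m) x = x) \<and>
     (\<forall>L\<in>modules_in R U. \<forall>M\<in>modules_in R U. \<forall>N\<in>modules_in R U.
        \<forall>f\<in>mod_hom R L M. \<forall>g\<in>mod_hom R M N. \<forall>x\<in>carrier (fob F L).
        fmap F L N (compose (carrier L) g f) x = fmap F M N g (fmap F L M f x)) \<and>
     (\<forall>M\<in>modules_in R U. \<forall>N\<in>modules_in R U.
        \<forall>f\<in>mod_hom R M N. \<forall>g\<in>mod_hom R M N. \<forall>x\<in>carrier (fob F M).
        fmap F M N (\<lambda>m\<in>carrier M. f m \<oplus>\<^bsub>N\<^esub> g m) x
          = fmap F M N f x \<otimes>\<^bsub>fob F N\<^esub> fmap F M N g x)}"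

definition nat_transf ::
  "('r, 'q) ring_scheme \<Rightarrow> 'u set set \<Rightarrow> ('r, 'u, 'v) mod_functor \<Rightarrow> ('r, 'u, 'v) mod_functor \<Rightarrow>
    (('r, 'u) module \<Rightarrow> 'v \<Rightarrow> 'v) set" where
  "nat_transf R U F G = {\<eta>.
     (\<forall>M\<in>modules_in R U. \<eta> M \<in> hom (fob F M) (fob G M)) \<and>
     (\<forall>M\<in>modules_in R U. \<forall>N\<in>modules_in R U. \<forall>f\<in>mod_hom R M N. \<forall>x\<in>carrier (fob F M).
        \<eta> N (fmap F M N f x) = fmap G M N f (\<eta> M x))}"

definition nat_zero ::
  "('r, 'q) ring_scheme \<Rightarrow> 'u set set \<Rightarrow> ('r, 'u, 'v) mod_functor \<Rightarrow> ('r, 'u, 'v) mod_functor \<Rightarrow>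
    (('r, 'u) module \<Rightarrow> 'v \<Rightarrow> 'v) \<Rightarrow> bool" where
  "nat_zero R U F G \<eta> \<longleftrightarrow>
     (\<forall>M\<in>modules_in R U. \<forall>x\<in>carrier (fob F M). \<eta> M x = \<one>\<^bsub>fob G M\<^esub>)"

definition nat_mono ::
  "('r, 'q) ring_scheme \<Rightarrow> 'u set set \<Rightarrow> ('r, 'u, 'v) mod_functor \<Rightarrow> ('r, 'u, 'v) mod_functor \<Rightarrow>
    (('r, 'u) module \<Rightarrow> 'v \<Rightarrow> 'v) set" where
  "nat_mono R U F G =
     {\<eta> \<in> nat_transf R U F G. \<forall>M\<in>modules_in R U. \<eta> M \<in> mon (fob F M) (fob G M)}"

definition nat_iso ::
  "('r, 'q) ring_scheme \<Rightarrow> 'u set set \<Rightarrow> ('r, 'u, 'v) mod_functor \<Rightarrow> ('r, 'u, 'v) mod_functor \<Rightarrow>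
    (('r, 'u) module \<Rightarrow> 'v \<Rightarrow> 'v) set" where
  "nat_iso R U F G =
     {\<eta> \<in> nat_transf R U F G. \<forall>M\<in>modules_in R U. \<eta> M \<in> iso (fob F M) (fob G M)}"

text \<open>
  The library writes exact sequences from right to left: the following says that
  \<open>0 \<longrightarrow> F \<longrightarrow> G \<longrightarrow> H \<longrightarrow> 0\<close>, with maps \<open>\<alpha>\<close> and \<open>\<beta>\<close>, is exact in each component.
\<close>

definition nat_short_exact ::
  "('r, 'q) ring_scheme \<Rightarrow> 'u set set \<Rightarrow> ('r, 'u, 'v) mod_functor \<Rightarrow> ('r, 'u, 'v) mod_functor \<Rightarrow>
    ('r, 'u, 'v) mod_functor \<Rightarrow> (('r, 'u) module \<Rightarrow> 'v \<Rightarrow> 'v) \<Rightarrow> (('r, 'u) module \<Rightarrow> 'v \<Rightarrow> 'v) \<Rightarrow> bool"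
  where
  "nat_short_exact R U F G H \<alpha> \<beta> \<longleftrightarrow>
     \<alpha> \<in> nat_transf R U F G \<and> \<beta> \<in> nat_transf R U G H \<and>
     (\<forall>M\<in>modules_in R U. short_exact_sequence (fob H M) (fob G M) (fob F M) (\<beta> M) (\<alpha> M))"

definition ker_functor ::
  "('r, 'u, 'v) mod_functor \<Rightarrow> ('r, 'u, 'v) mod_functor \<Rightarrow> (('r, 'u) module \<Rightarrow> 'v \<Rightarrow> 'v) \<Rightarrow>
    ('r, 'u, 'v) mod_functor" where
  "ker_functor F G \<eta> =
     \<lparr>fob = (\<lambda>M. (fob F M)\<lparr>carrier := kernel (fob F M) (fob G M) (\<eta> M)\<rparr>), fmap = fmap F\<rparr>"


section \<open>The injective stabilization\<close>

definition injective_module ::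
  "('r, 'q) ring_scheme \<Rightarrow> 'u set set \<Rightarrow> ('r, 'u) module \<Rightarrow> bool" where
  "injective_module R U I \<longleftrightarrow>
     I \<in> modules_in R U \<and>
     (\<forall>M\<in>modules_in R U. \<forall>N\<in>modules_in R U. \<forall>i\<in>mod_mono R M N. \<forall>f\<in>mod_hom R M I.
        \<exists>g\<in>mod_hom R N I. compose (carrier M) g i = f)"

record ('r, 'u) copresentation =
  cp_I0 :: "('r, 'u) module"
  cp_I1 :: "('r, 'u) module"
  cp_iota :: "'u \<Rightarrow> 'u"
  cp_del :: "'u \<Rightarrow> 'u"

definition is_inj_copresentation ::
  "('r, 'q) ring_scheme \<Rightarrow> 'u set set \<Rightarrow> ('r, 'u) module \<Rightarrow> ('r, 'u) copresentation \<Rightarrow> bool" where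
  "is_inj_copresentation R U B c \<longleftrightarrow>
     injective_module R U (cp_I0 c) \<and> injective_module R U (cp_I1 c) \<and>
     cp_iota c \<in> mod_mono R B (cp_I0 c) \<and>
     cp_del c \<in> mod_hom R (cp_I0 c) (cp_I1 c) \<and>
     cp_iota c ` carrier B = {y \<in> carrier (cp_I0 c). cp_del c y = \<zero>\<^bsub>cp_I1 c\<^esub>}"

text \<open>
  For each module one injective copresentation is chosen once and for all, and for each
  homomorphism one extension to the injective modules \<open>I\<^sup>0\<close>; the latter gives the action of
  \<open>R\<^sup>0F\<close> on morphisms.
\<close>

definition inj_copresentation ::
  "('r, 'q) ring_scheme \<Rightarrow> 'u set set \<Rightarrow> ('r, 'u) module \<Rightarrow> ('r, 'u) copresentation" where
  "inj_copresentation R U B = (SOME c. is_inj_copresentation R U B c)"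

definition inj_lift ::
  "('r, 'q) ring_scheme \<Rightarrow> 'u set set \<Rightarrow> ('r, 'u) module \<Rightarrow> ('r, 'u) module \<Rightarrow> ('u \<Rightarrow> 'u) \<Rightarrow> 'u \<Rightarrow> 'u"
  where
  "inj_lift R U B C f = (SOME g.
     g \<in> mod_hom R (cp_I0 (inj_copresentation R U B)) (cp_I0 (inj_copresentation R U C)) \<and>
     compose (carrier B) g (cp_iota (inj_copresentation R U B))
       = compose (carrier B) (cp_iota (inj_copresentation R U C)) f)"

definition R0 ::
  "('r, 'q) ring_scheme \<Rightarrow> 'u set set \<Rightarrow> ('r, 'u, 'v) mod_functor \<Rightarrow> ('r, 'u, 'v) mod_functor" where
  "R0 R U F =
     \<lparr>fob = (\<lambda>B. let c = inj_copresentation R U B in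
        (fob F (cp_I0 c))\<lparr>carrier :=
          kernel (fob F (cp_I0 c)) (fob F (cp_I1 c)) (fmap F (cp_I0 c) (cp_I1 c) (cp_del c))\<rparr>),
      fmap = (\<lambda>B C f. fmap F (cp_I0 (inj_copresentation R U B)) (cp_I0 (inj_copresentation R U C))
        (inj_lift R U B C f))\<rparr>"

definition rho ::
  "('r, 'q) ring_scheme \<Rightarrow> 'u set set \<Rightarrow> ('r, 'u, 'v) mod_functor \<Rightarrow> ('r, 'u) module \<Rightarrow> 'v \<Rightarrow> 'v" where
  "rho R U F B = (let c = inj_copresentation R U B in fmap F B (cp_I0 c) (cp_iota c))"

definition inj_stabilization ::
  "('r, 'q) ring_scheme \<Rightarrow> 'u set set \<Rightarrow> ('r, 'u, 'v) mod_functor \<Rightarrow> ('r, 'u, 'v) mod_functor" where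
  "inj_stabilization R U F = ker_functor F (R0 R U F) (rho R U F)"

definition injectively_stable_functors ::
  "('r, 'q) ring_scheme \<Rightarrow> 'u set set \<Rightarrow> 'v set set \<Rightarrow> ('r, 'u, 'v) mod_functor set" where
  "injectively_stable_functors R U V =
     {F \<in> additive_functors R U V. (\<lambda>B x. x) \<in> nat_iso R U (inj_stabilization R U F) F}"

definition mono_preserving_functors ::
  "('r, 'q) ring_scheme \<Rightarrow> 'u set set \<Rightarrow> 'v set set \<Rightarrow> ('r, 'u, 'v) mod_functor set" where
  "mono_preserving_functors R U V =
     {F \<in> additive_functors R U V.
        \<forall>M\<in>modules_in R U. \<forall>N\<in>modules_in R U. \<forall>f\<in>mod_mono R M N.
          fmap F M N f \<in> mon (fob F M) (fob F N)}"


section \<open>Torsion theories of additive functors\<close>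

definition iso_closed ::
  "('r, 'q) ring_scheme \<Rightarrow> 'u set set \<Rightarrow> 'v set set \<Rightarrow> ('r, 'u, 'v) mod_functor set \<Rightarrow> bool" where
  "iso_closed R U V \<C> \<longleftrightarrow>
     (\<forall>F\<in>\<C>. \<forall>G\<in>additive_functors R U V. nat_iso R U F G \<noteq> {} \<longrightarrow> G \<in> \<C>)"

definition torsion_theory ::
  "('r, 'q) ring_scheme \<Rightarrow> 'u set set \<Rightarrow> 'v set set \<Rightarrow>
    ('r, 'u, 'v) mod_functor set \<Rightarrow> ('r, 'u, 'v) mod_functor set \<Rightarrow> bool" where
  "torsion_theory R U V \<T> \<F> \<longleftrightarrow>
     \<T> \<subseteq> additive_functors R U V \<and> \<F> \<subseteq> additive_functors R U V \<and>
     iso_closed R U V \<T> \<and> iso_closed R U V \<F> \<and>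
     (\<forall>T\<in>\<T>. \<forall>Y\<in>\<F>. \<forall>\<eta>\<in>nat_transf R U T Y. nat_zero R U T Y \<eta>) \<and>
     (\<forall>X\<in>additive_functors R U V. \<exists>T\<in>\<T>. \<exists>Y\<in>\<F>. \<exists>\<alpha> \<beta>. nat_short_exact R U T X Y \<alpha> \<beta>)"

definition hereditary_torsion_theory ::
  "('r, 'q) ring_scheme \<Rightarrow> 'u set set \<Rightarrow> 'v set set \<Rightarrow>
    ('r, 'u, 'v) mod_functor set \<Rightarrow> ('r, 'u, 'v) mod_functor set \<Rightarrow> bool" where
  "hereditary_torsion_theory R U V \<T> \<F> \<longleftrightarrow>
     torsion_theory R U V \<T> \<F> \<and>
     (\<forall>T\<in>\<T>. \<forall>S\<in>additive_functors R U V. nat_mono R U S T \<noteq> {} \<longrightarrow> S \<in> \<T>)"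

end

theory Submission
  imports Defs "HOL-Algebra.Free_Abelian_Groups"
begin

text \<open>
  Let \<open>\<iota>\<close> be the chosen embedding of a module \<open>B\<close> into an injective \<open>I\<^sup>0\<close>, and call an element
  of \<open>F(B)\<close> torsion if \<open>F(\<iota>)\<close> kills it. The one observation behind the theorem is that torsion does
  not depend on the choice: if any monomorphism \<open>j : B \<longrightarrow> N\<close> kills an element, then \<open>\<iota>\<close> factors as
  \<open>g \<circ> j\<close> by injectivity of \<open>I\<^sup>0\<close>, so \<open>F(\<iota>) = F(g) \<circ> F(j)\<close> kills it as well
  (\<open>rho_eq_one_if_killed_by_mono\<close>). An injectively stable functor is one all of whose elements are
  torsion (\<open>injectively_stable_iff\<close>), and a functor that preserves monomorphisms has no torsion
  but the trivial one. Natural transformations carry torsion to torsion, which gives the vanishing of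
  every transformation from the first kind to the second; torsion is also reflected by componentwise
  injective transformations, which gives heredity.

  For the short exact sequence of a functor \<open>F\<close> the subobject is the injective stabilization. The
  quotient is realised as the image of \<open>\<rho>\<close> inside \<open>R\<^sup>0F\<close> (\<open>rho_image\<close>). Let
  \<open>f : M \<longrightarrow> N\<close> be a monomorphism whose image under this quotient functor kills \<open>\<rho>(x)\<close>. Then
  \<open>F\<close> of the monomorphism \<open>\<iota> \<circ> f\<close> kills \<open>x\<close>, so \<open>x\<close> is torsion and \<open>\<rho>(x)\<close> is trivial; hence
  the quotient preserves monomorphisms.

  All of this presupposes that injective copresentations exist in the given universe
  (\<open>exists_inj_copresentation\<close>), and most of the work lies there. A divisible abelian group \<open>D\<close> is
  injective among abelian groups (\<open>divisible_group_injective\<close>, by Zorn's lemma), and therefore the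
  module of additive maps from \<open>R\<close> to \<open>D\<close> is injective among \<open>R\<close>-modules
  (\<open>coinduced_module_injective\<close>). A homomorphism \<open>\<phi>\<close> of abelian groups from a module \<open>M\<close> to \<open>D\<close> yields
  the module homomorphism \<open>x \<mapsto> (r \<mapsto> \<phi>(r x))\<close>; if the kernel of \<open>\<phi>\<close> is a submodule, both have the same kernel.
  As every subgroup \<open>K\<close> of \<open>M\<close> is the kernel of a homomorphism to a divisible group
  (\<open>exists_hom_to_divisible_group_with_kernel\<close>), every submodule of \<open>M\<close> is the kernel of a
  homomorphism to an injective module. The submodule \<open>0\<close> of \<open>B\<close> gives \<open>\<iota>\<close>, and the image of \<open>\<iota>\<close>
  gives \<open>\<partial>\<close>. The divisible group is a quotient of a rational vector space with basis \<open>M\<close>, so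
  that it is no larger than the larger of \<open>M\<close> and the set of natural numbers; this keeps the injective module inside
  the universe.
\<close>


section \<open>Divisible abelian groups are injective\<close>

definition divisible_group :: "('a, 'b) monoid_scheme \<Rightarrow> bool" where
  "divisible_group D \<longleftrightarrow>
     comm_group D \<and> (\<forall>n::nat. n > 0 \<longrightarrow> (\<forall>d\<in>carrier D. \<exists>e\<in>carrier D. e [^]\<^bsub>D\<^esub> n = d))"

lemma int_pow_DirProd:
  assumes "group N" "group D" "x \<in> carrier N" "d \<in> carrier D"
  shows "(x, d) [^]\<^bsub>N \<times>\<times> D\<^esub> (k::int) = (x [^]\<^bsub>N\<^esub> k, d [^]\<^bsub>D\<^esub> k)"
proof -
  have g: "group (N \<times>\<times> D)" using assms by (simp add: DirProd_group)
  have c: "(x, d) \<in> carrier (N \<times>\<times> D)" using assms by simp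
  have "fst \<in> hom (N \<times>\<times> D) N" "snd \<in> hom (N \<times>\<times> D) D"
    by (auto simp: hom_def)
  then have "fst ((x, d) [^]\<^bsub>N \<times>\<times> D\<^esub> k) = x [^]\<^bsub>N\<^esub> k" "snd ((x, d) [^]\<^bsub>N \<times>\<times> D\<^esub> k) = d [^]\<^bsub>D\<^esub> k"
    using hom_int_pow[OF _ c g] assms by fastforce+
  then show ?thesis by (metis prod.collapse)
qed

text \<open>
  Partial homomorphisms from \<open>N\<close> to \<open>D\<close> are represented by their graphs, so that extension is
  inclusion of sets and Zorn's lemma applies to unions of chains. For a subgroup of the product,
  being single-valued can be tested over the unit element alone.
\<close>

definition partial_hom_graph ::
  "('a, 'c) monoid_scheme \<Rightarrow> ('b, 'd) monoid_scheme \<Rightarrow> ('a \<times> 'b) set \<Rightarrow> bool" where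
  "partial_hom_graph N D S \<longleftrightarrow>
     subgroup S (N \<times>\<times> D) \<and> (\<forall>d. (\<one>\<^bsub>N\<^esub>, d) \<in> S \<longrightarrow> d = \<one>\<^bsub>D\<^esub>)"

lemma partial_hom_graph_Union_chain:
  assumes "group N" "group D" "\<C> \<noteq> {}"
    and chain: "\<And>S T. S \<in> \<C> \<Longrightarrow> T \<in> \<C> \<Longrightarrow> S \<subseteq> T \<or> T \<subseteq> S"
    and graphs: "\<And>S. S \<in> \<C> \<Longrightarrow> partial_hom_graph N D S"
  shows "partial_hom_graph N D (\<Union>\<C>)"
proof -
  have sub: "subgroup S (N \<times>\<times> D)" if "S \<in> \<C>" for S
    using graphs[OF that] by (simp add: partial_hom_graph_def)
  have "subgroup (\<Union>\<C>) (N \<times>\<times> D)"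
  proof (rule subgroup.intro)
    show "\<Union>\<C> \<subseteq> carrier (N \<times>\<times> D)" using subgroup.subset[OF sub] by blast
    show "x \<otimes>\<^bsub>N \<times>\<times> D\<^esub> y \<in> \<Union>\<C>" if xy: "x \<in> \<Union>\<C>" "y \<in> \<Union>\<C>" for x y
    proof -
      from xy obtain S T where ST: "S \<in> \<C>" "T \<in> \<C>" "x \<in> S" "y \<in> T" by blast
      then obtain W where "W \<in> \<C>" "x \<in> W" "y \<in> W" using chain by blast
      then show ?thesis using subgroup.m_closed[OF sub] by blast
    qed
    show "\<one>\<^bsub>N \<times>\<times> D\<^esub> \<in> \<Union>\<C>" using assms(3) subgroup.one_closed[OF sub] by blast
    show "inv\<^bsub>N \<times>\<times> D\<^esub> x \<in> \<Union>\<C>" if "x \<in> \<Union>\<C>" for x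
      using that subgroup.m_inv_closed[OF sub] by blast
  qed
  then show ?thesis using graphs unfolding partial_hom_graph_def by blast
qed

text \<open>
  The exponents \<open>k\<close> for which \<open>x\<^sup>k\<close> lies in the domain of the partial homomorphism are the multiples
  of some \<open>n\<close>. If \<open>n\<close> is positive, \<open>d\<close> has to be an \<open>n\<close>-th root of the value at \<open>x\<^sup>n\<close>, and divisibility
  provides one; if \<open>n = 0\<close>, any \<open>d\<close> will do.
\<close>

lemma divisible_value_for_new_element:
  assumes N: "group N" and D: "divisible_group D"
    and S: "partial_hom_graph N D S" and x: "x \<in> carrier N"
  shows "\<exists>d\<in>carrier D. \<forall>(k::int) e. (x [^]\<^bsub>N\<^esub> k, e) \<in> S \<longrightarrow> e = d [^]\<^bsub>D\<^esub> k"
proof -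
  interpret N: group N by fact
  interpret D: comm_group D using D by (simp add: divisible_group_def)
  interpret ND: group "N \<times>\<times> D" by (simp add: DirProd_group)
  interpret S: subgroup S "N \<times>\<times> D" using S by (simp add: partial_hom_graph_def)
  have carr: "a \<in> carrier N" "e \<in> carrier D" if "(a, e) \<in> S" for a e
    using S.subset that by auto
  have sv: "d = \<one>\<^bsub>D\<^esub>" if "(\<one>\<^bsub>N\<^esub>, d) \<in> S" for d
    using S that by (simp add: partial_hom_graph_def)
  have pw: "(a [^]\<^bsub>N\<^esub> k, e [^]\<^bsub>D\<^esub> k) \<in> S" if "(a, e) \<in> S" for a e and k :: int
    using ND.subgroup_int_pow_closed[OF S.subgroup_axioms that, of k] carr[OF that]
    by (simp add: int_pow_DirProd)
  have ml: "(a \<otimes>\<^bsub>N\<^esub> b, d \<otimes>\<^bsub>D\<^esub> e) \<in> S" if "(a, d) \<in> S" "(b, e) \<in> S" for a b d e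
    using S.m_closed[OF that] by simp
  let ?P = "\<lambda>n::nat. n > 0 \<and> (\<exists>e. (x [^]\<^bsub>N\<^esub> int n, e) \<in> S)"
  show ?thesis
  proof (cases "\<exists>n. ?P n")
    case True
    define n where "n = (LEAST n. ?P n)"
    have n: "?P n" unfolding n_def by (rule LeastI_ex) (rule True)
    have least: "\<not> ?P m" if "m < n" for m using not_less_Least that unfolding n_def by blast
    from n obtain e where e: "(x [^]\<^bsub>N\<^esub> int n, e) \<in> S" by blast
    obtain d where d: "d \<in> carrier D" "d [^]\<^bsub>D\<^esub> n = e"
      using D n carr[OF e] unfolding divisible_group_def by blast
    have "e' = d [^]\<^bsub>D\<^esub> k" if k: "(x [^]\<^bsub>N\<^esub> k, e') \<in> S" for k :: int and e'
    proof -
      define q r where "q = k div int n" and "r = k mod int n"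
      have kqr: "k = int n * q + r" by (simp add: q_def r_def)
      have r: "0 \<le> r" "r < int n" using n by (auto simp: r_def)
      have "(x [^]\<^bsub>N\<^esub> (int n * (- q)), e [^]\<^bsub>D\<^esub> (- q)) \<in> S"
        using pw[OF e, of "- q"] x by (simp add: N.int_pow_pow)
      from ml[OF k this] have *: "(x [^]\<^bsub>N\<^esub> r, e' \<otimes>\<^bsub>D\<^esub> e [^]\<^bsub>D\<^esub> (- q)) \<in> S"
        using x by (simp add: N.int_pow_mult[symmetric] kqr)
      \<comment> \<open>The remainder is an exponent of the domain too, so it vanishes by minimality of \<open>n\<close>.\<close>
      have "nat r < n" using r by linarith
      then have "\<not> 0 < nat r" using least[of "nat r"] * r by auto
      then have r0: "r = 0" using r by simp
      then have "e' \<otimes>\<^bsub>D\<^esub> e [^]\<^bsub>D\<^esub> (- q) = \<one>\<^bsub>D\<^esub>" using * sv by simp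
      then have "e' = e [^]\<^bsub>D\<^esub> q"
        using carr[OF k] carr[OF e]
        by (metis D.int_pow_closed D.int_pow_neg D.inv_closed D.inv_equality D.inv_inv)
      also have "\<dots> = d [^]\<^bsub>D\<^esub> k"
        using d kqr r0 by (auto simp: D.int_pow_pow mult.commute simp flip: int_pow_int)
      finally show ?thesis .
    qed
    then show ?thesis using d by blast
  next
    case False
    have "e = \<one>\<^bsub>D\<^esub> [^]\<^bsub>D\<^esub> k" if k: "(x [^]\<^bsub>N\<^esub> k, e) \<in> S" for k :: int and e
    proof -
      \<comment> \<open>A nonzero \<open>k\<close> would give the positive exponent \<open>\<bar>k\<bar>\<close> in the domain.\<close>
      have "(x [^]\<^bsub>N\<^esub> (k * sgn k), e [^]\<^bsub>D\<^esub> sgn k) \<in> S"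
        using pw[OF k, of "sgn k"] x by (simp add: N.int_pow_pow)
      then have "(x [^]\<^bsub>N\<^esub> int (nat \<bar>k\<bar>), e [^]\<^bsub>D\<^esub> sgn k) \<in> S"
        by (simp only: abs_sgn[symmetric] abs_ge_zero int_nat_eq if_True)
      then have "k = 0" using False by (metis zero_less_abs_iff zero_less_nat_eq)
      then show ?thesis using k sv by simp
    qed
    then show ?thesis by blast
  qed
qed

text \<open>
  The new graph is the product of \<open>S\<close> with the cyclic group generated by \<open>(x, d)\<close>. An element
  \<open>(y, c) \<cdot> (x, d)\<^sup>k\<close> over the unit has \<open>x\<^sup>k = y\<^sup>-\<^sup>1\<close>, and \<open>d\<close> was chosen so that then
  \<open>d\<^sup>k = c\<^sup>-\<^sup>1\<close>.
\<close>

lemma partial_hom_graph_extend: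
  assumes N: "comm_group N" and D: "divisible_group D"
    and S: "partial_hom_graph N D S" and x: "x \<in> carrier N"
  shows "\<exists>T d. partial_hom_graph N D T \<and> S \<subseteq> T \<and> (x, d) \<in> T"
proof -
  interpret N: comm_group N by fact
  interpret D: comm_group D using D by (simp add: divisible_group_def)
  interpret ND: comm_group "N \<times>\<times> D"
    using DirProd_group[OF N.is_group D.is_group] 
    by (intro group.group_comm_groupI) (auto simp: N.m_comm D.m_comm)
  interpret S: subgroup S "N \<times>\<times> D" using S by (simp add: partial_hom_graph_def)
  have sv: "d = \<one>\<^bsub>D\<^esub>" if "(\<one>\<^bsub>N\<^esub>, d) \<in> S" for d
    using S that by (simp add: partial_hom_graph_def)
  obtain d where d: "d \<in> carrier D"
    and val: "\<And>(k::int) e. (x [^]\<^bsub>N\<^esub> k, e) \<in> S \<Longrightarrow> e = d [^]\<^bsub>D\<^esub> k"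
    using divisible_value_for_new_element[OF N.is_group D S x] by blast
  let ?p = "(x, d)"
  define Z where "Z = range (\<lambda>k::int. ?p [^]\<^bsub>N \<times>\<times> D\<^esub> k)"
  have p: "?p \<in> carrier (N \<times>\<times> D)" using x d by simp
  have Z: "subgroup Z (N \<times>\<times> D)"
  proof (rule subgroup.intro)
    show "Z \<subseteq> carrier (N \<times>\<times> D)" unfolding Z_def using ND.int_pow_closed[OF p] by blast
    show "a \<otimes>\<^bsub>N \<times>\<times> D\<^esub> b \<in> Z" if "a \<in> Z" "b \<in> Z" for a b
      using that p ND.int_pow_mult[symmetric, OF p] unfolding Z_def by blast
    show "\<one>\<^bsub>N \<times>\<times> D\<^esub> \<in> Z" unfolding Z_def by (metis int_pow_0 rangeI)
    show "inv\<^bsub>N \<times>\<times> D\<^esub> a \<in> Z" if "a \<in> Z" for a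
      using that p ND.int_pow_neg[symmetric, OF p] unfolding Z_def by blast
  qed
  define T where "T = S <#>\<^bsub>N \<times>\<times> D\<^esub> Z"
  have "subgroup T (N \<times>\<times> D)"
    unfolding T_def using ND.mult_subgroups S.subgroup_axioms Z by blast
  moreover have "e = \<one>\<^bsub>D\<^esub>" if e: "(\<one>\<^bsub>N\<^esub>, e) \<in> T" for e
  proof -
    obtain y c and k :: int where yc: "(y, c) \<in> S"
      and eq: "(\<one>\<^bsub>N\<^esub>, e) = (y, c) \<otimes>\<^bsub>N \<times>\<times> D\<^esub> ?p [^]\<^bsub>N \<times>\<times> D\<^esub> k"
      using e unfolding T_def Z_def set_mult_def by auto
    have yc': "y \<in> carrier N" "c \<in> carrier D" using S.subset yc by auto
    have eqs: "y \<otimes>\<^bsub>N\<^esub> x [^]\<^bsub>N\<^esub> k = \<one>\<^bsub>N\<^esub>" "e = c \<otimes>\<^bsub>D\<^esub> d [^]\<^bsub>D\<^esub> k"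
      using eq x d by (simp_all add: int_pow_DirProd)
    have "(inv\<^bsub>N\<^esub> y, inv\<^bsub>D\<^esub> c) \<in> S" using S.m_inv_closed[OF yc] yc' by (simp add: inv_DirProd)
    moreover have "x [^]\<^bsub>N\<^esub> k = inv\<^bsub>N\<^esub> y"
      using eqs(1) yc' x by (metis N.int_pow_closed N.inv_equality N.m_comm)
    ultimately have "inv\<^bsub>D\<^esub> c = d [^]\<^bsub>D\<^esub> k" using val by simp
    then show ?thesis using eqs(2) yc' by (metis D.r_inv)
  qed
  moreover have "S \<subseteq> T"
  proof
    fix s assume s: "s \<in> S"
    have "s = s \<otimes>\<^bsub>N \<times>\<times> D\<^esub> \<one>\<^bsub>N \<times>\<times> D\<^esub>" using s S.subset by (metis ND.r_one subsetD)
    then show "s \<in> T" unfolding T_def set_mult_def using s subgroup.one_closed[OF Z] by blast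
  qed
  moreover have "?p \<in> T"
  proof -
    have "?p \<in> Z" unfolding Z_def by (metis ND.int_pow_1 p rangeI)
    moreover have "?p = \<one>\<^bsub>N \<times>\<times> D\<^esub> \<otimes>\<^bsub>N \<times>\<times> D\<^esub> ?p" using p by (metis ND.l_one)
    ultimately show ?thesis unfolding T_def set_mult_def using S.one_closed by blast
  qed
  ultimately show ?thesis unfolding partial_hom_graph_def by blast
qed

text \<open>
  A maximal extension of the graph of \<open>f \<circ> i\<^sup>-\<^sup>1\<close> is defined everywhere, since otherwise it could
  be extended by one more element.
\<close>

proposition divisible_group_injective:
  assumes M: "comm_group M" and N: "comm_group N" and D: "divisible_group D"
    and i: "i \<in> mon M N" and f: "f \<in> hom M D"
  shows "\<exists>g\<in>hom N D. \<forall>m\<in>carrier M. g (i m) = f m"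
proof -
  interpret M: comm_group M by fact
  interpret N: comm_group N by fact
  interpret D: comm_group D using D by (simp add: divisible_group_def)
  have ih: "i \<in> hom M N" and inj: "inj_on i (carrier M)" using i by (auto simp: mon_def)
  interpret i: group_hom M N i by unfold_locales (rule ih)
  interpret f: group_hom M D f by unfold_locales (rule f)
  define G where "G = (\<lambda>m. (i m, f m)) ` carrier M"
  have "(\<lambda>m. (i m, f m)) \<in> hom M (N \<times>\<times> D)"
    by (intro homI) auto
  then interpret pair: group_hom M "N \<times>\<times> D" "\<lambda>m. (i m, f m)"
    using DirProd_group[OF N.is_group D.is_group] by (simp add: group_hom_def group_hom_axioms_def M.is_group)
  have "subgroup G (N \<times>\<times> D)" unfolding G_def by (rule pair.img_is_subgroup)
  moreover have "f m = \<one>\<^bsub>D\<^esub>" if "m \<in> carrier M" "i m = \<one>\<^bsub>N\<^esub>" for m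
    using inj_onD[OF inj, of m "\<one>\<^bsub>M\<^esub>"] that by simp
  ultimately have G: "partial_hom_graph N D G"
    unfolding partial_hom_graph_def G_def by auto
  define A where "A = {S. partial_hom_graph N D S \<and> G \<subseteq> S}"
  have "\<exists>S\<in>A. \<forall>X\<in>A. S \<subseteq> X \<longrightarrow> X = S"
  proof (rule subset_Zorn_nonempty)
    show "A \<noteq> {}" unfolding A_def using G by blast
    fix \<C> assume ne: "\<C> \<noteq> {}" and ch: "subset.chain A \<C>"
    have "partial_hom_graph N D (\<Union>\<C>)"
      using ch by (intro partial_hom_graph_Union_chain[OF N.is_group D.is_group ne])
        (auto simp: subset_chain_def A_def)
    then show "\<Union>\<C> \<in> A" using ne ch by (fastforce simp: subset_chain_def A_def)
  qed
  then obtain S where S: "partial_hom_graph N D S" "G \<subseteq> S"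
    and mx: "\<And>X. partial_hom_graph N D X \<Longrightarrow> S \<subseteq> X \<Longrightarrow> X = S"
    unfolding A_def by auto
  have total: "\<exists>d. (x, d) \<in> S" if "x \<in> carrier N" for x
    using partial_hom_graph_extend[OF N D S(1) that] mx by blast
  interpret S: subgroup S "N \<times>\<times> D" using S(1) by (simp add: partial_hom_graph_def)
  have carr: "a \<in> carrier N" "e \<in> carrier D" if "(a, e) \<in> S" for a e
    using S.subset that by auto
  have uniq: "d = e" if d: "(x, d) \<in> S" and e: "(x, e) \<in> S" for x d e
  proof -
    have "(x \<otimes>\<^bsub>N\<^esub> inv\<^bsub>N\<^esub> x, d \<otimes>\<^bsub>D\<^esub> inv\<^bsub>D\<^esub> e) \<in> S"
      using S.m_closed[OF d S.m_inv_closed[OF e]] carr[OF e]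
      by (simp add: inv_DirProd N.is_group D.is_group)
    then have "d \<otimes>\<^bsub>D\<^esub> inv\<^bsub>D\<^esub> e = \<one>\<^bsub>D\<^esub>"
      using S(1) carr[OF e] unfolding partial_hom_graph_def by simp
    then show ?thesis using carr[OF d] carr[OF e]
      using D.inv_equality by fastforce
  qed
  define g where "g = (\<lambda>x. SOME d. (x, d) \<in> S)"
  have gS: "(x, g x) \<in> S" if "x \<in> carrier N" for x
    unfolding g_def using total[OF that] by (rule someI_ex)
  have "g \<in> hom N D"
  proof (rule homI)
    show "g x \<in> carrier D" if "x \<in> carrier N" for x using carr gS[OF that] by blast
    show "g (x \<otimes>\<^bsub>N\<^esub> y) = g x \<otimes>\<^bsub>D\<^esub> g y" if xy: "x \<in> carrier N" "y \<in> carrier N" for x y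
    proof (rule uniq[OF gS])
      show "x \<otimes>\<^bsub>N\<^esub> y \<in> carrier N" using xy by simp
      show "(x \<otimes>\<^bsub>N\<^esub> y, g x \<otimes>\<^bsub>D\<^esub> g y) \<in> S" using S.m_closed[OF gS gS] xy by simp
    qed
  qed
  moreover have "g (i m) = f m" if "m \<in> carrier M" for m
  proof (rule uniq[OF gS])
    show "i m \<in> carrier N" using that by simp
    show "(i m, f m) \<in> S" using S(2) that unfolding G_def by blast
  qed
  ultimately show ?thesis by blast
qed


section \<open>Every subgroup is the kernel of a map to a small divisible group\<close>

text \<open>
  The rational vector space with basis \<open>S\<close>, that is, the divisible hull of the free abelian group
  on \<open>S\<close>.
\<close>

definition rational_free_group :: "'a set \<Rightarrow> ('a \<Rightarrow> rat) monoid" where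
  "rational_free_group S =
     \<lparr>carrier = {q. {x. q x \<noteq> 0} \<subseteq> S \<and> finite {x. q x \<noteq> 0}},
      monoid.mult = (\<lambda>p q x. p x + q x), one = (\<lambda>x. 0)\<rparr>"

lemma divisible_rational_free_group: "divisible_group (rational_free_group S)"
proof -
  let ?L = "rational_free_group S"
  have closed: "(\<lambda>x. p x + q x) \<in> carrier ?L" if "p \<in> carrier ?L" "q \<in> carrier ?L" for p q
  proof -
    have "{x. p x + q x \<noteq> 0} \<subseteq> {x. p x \<noteq> 0} \<union> {x. q x \<noteq> 0}" by auto
    then show ?thesis using that
      by (auto simp: rational_free_group_def intro: finite_subset)
  qed
  have "comm_group ?L"
  proof (rule comm_groupI)
    show "\<exists>q\<in>carrier ?L. q \<otimes>\<^bsub>?L\<^esub> p = \<one>\<^bsub>?L\<^esub>" if "p \<in> carrier ?L" for p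
      by (rule bexI[of _ "\<lambda>x. - p x"]) (use that in \<open>auto simp: rational_free_group_def\<close>)
    show "p \<otimes>\<^bsub>?L\<^esub> q \<in> carrier ?L" if "p \<in> carrier ?L" "q \<in> carrier ?L" for p q
      using closed[OF that] by (simp add: rational_free_group_def)
  qed (auto simp: rational_free_group_def add.assoc add.commute)
  moreover have "\<exists>p\<in>carrier ?L. p [^]\<^bsub>?L\<^esub> n = q" if "n > 0" "q \<in> carrier ?L" for n :: nat and q
  proof (rule bexI)
    have "p [^]\<^bsub>?L\<^esub> n = (\<lambda>x. of_nat n * p x)" for p
      by (induction n) (auto simp: nat_pow_def rational_free_group_def algebra_simps)
    then show "(\<lambda>x. q x / of_nat n) [^]\<^bsub>?L\<^esub> n = q" using that by simp
    show "(\<lambda>x. q x / of_nat n) \<in> carrier ?L" using that by (simp add: rational_free_group_def)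
  qed
  ultimately show ?thesis by (simp add: divisible_group_def)
qed

lemma infinite_Times_lepoll_self:
  assumes "infinite C"
  shows "C \<times> C \<lesssim> C"
  using card_of_Times_same_infinite[OF assms]
  by (simp add: eqpoll_imp_lepoll eqpoll_iff_card_of_ordIso)

text \<open>
  A bound in terms of an infinite set of size at least \<open>S\<close>, rather than of its power set, is essential: a
  module universe over a finite ring may consist of the countable sets alone.
\<close>

lemma rational_free_group_lepoll:
  assumes "infinite C" "S \<lesssim> C" "S \<noteq> {}"
  shows "carrier (rational_free_group S) \<lesssim> C"
proof -
  have "carrier (rational_free_group S) \<lesssim> Fpow (S \<times> (UNIV :: rat set))"
    using lepoll_restricted_funspace[of S UNIV "\<lambda>_. 0::rat"] by (simp add: rational_free_group_def)
  also have "\<dots> \<approx> S \<times> (UNIV :: rat set)"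
    using assms(3) by (intro eqpoll_Fpow) (simp add: finite_cartesian_product_iff infinite_UNIV_char_0)
  also have "\<dots> \<lesssim> C \<times> C"
  proof (rule times_lepoll_mono[OF assms(2)])
    have "(UNIV :: rat set) \<lesssim> (UNIV :: nat set)"
      unfolding lepoll_def using inj_to_nat by blast
    also have "\<dots> \<lesssim> C" using assms(1) by (simp add: infinite_le_lepoll)
    finally show "(UNIV :: rat set) \<lesssim> C" .
  qed
  also have "\<dots> \<lesssim> C" by (rule infinite_Times_lepoll_self) fact
  finally show ?thesis .
qed

lemma divisible_FactGroup:
  assumes "divisible_group L" "subgroup N L"
  shows "divisible_group (L Mod N)"
proof -
  interpret L: comm_group L using assms(1) by (simp add: divisible_group_def)
  have N: "N \<lhd> L" using assms(2) by (simp add: L.normal_iff_subgroup)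
  have "\<exists>E\<in>carrier (L Mod N). E [^]\<^bsub>L Mod N\<^esub> n = Q" if n: "n > 0" and Q: "Q \<in> carrier (L Mod N)"
    for n :: nat and Q
  proof -
    obtain q where q: "q \<in> carrier L" "Q = N #>\<^bsub>L\<^esub> q" using Q by (auto simp: carrier_FactGroup)
    obtain e where e: "e \<in> carrier L" "e [^]\<^bsub>L\<^esub> n = q"
      using assms(1) n q(1) unfolding divisible_group_def by blast
    show ?thesis
      using normal.FactGroup_pow[OF N e(1), of n] e q by (auto simp: carrier_FactGroup)
  qed
  then show ?thesis using L.abelian_FactGroup[OF assms(2)] by (simp add: divisible_group_def)
qed

text \<open>
  Present \<open>G\<close> as the image of the free abelian group on its own elements. The integral combinations
  that are sent into \<open>K\<close> form a subgroup of the rational vector space with the same basis; the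
  quotient \<open>D\<close> by it is divisible, and \<open>g\<close> goes to the class of its basis vector. An arbitrary
  kernel \<open>K\<close> costs no more than the trivial one, and saves the formation of quotient modules later on.
\<close>

proposition exists_hom_to_divisible_group_with_kernel:
  fixes G :: "('a, 'b) monoid_scheme"
  assumes G: "comm_group G" and K: "subgroup K G" and C: "infinite C" "carrier G \<lesssim> C"
  obtains D :: "('a \<Rightarrow> rat) set monoid" and \<phi>
  where "divisible_group D" "carrier D \<lesssim> C" "\<phi> \<in> hom G D" "kernel G D \<phi> = K"
proof -
  interpret G: comm_group G by fact
  interpret K: subgroup K G by fact
  let ?S = "carrier G"
  let ?F = "free_Abelian_group ?S"
  define L where "L = rational_free_group ?S"
  have divL: "divisible_group L" by (simp add: L_def divisible_rational_free_group)
  interpret L: comm_group L using divL by (simp add: divisible_group_def)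
  interpret F: comm_group ?F by (rule abelian_free_Abelian_group)
  obtain h where h: "h \<in> hom ?F G" and h_of: "\<And>x. x \<in> ?S \<Longrightarrow> h (frag_of x) = x"
    using G.free_Abelian_group_universal[of "\<lambda>x. x" ?S] by auto
  interpret h: group_hom ?F G h by unfold_locales (rule h)
  define j :: "('a \<Rightarrow>\<^sub>0 int) \<Rightarrow> 'a \<Rightarrow> rat" where "j = (\<lambda>c x. of_int (poly_mapping.lookup c x))"
  have j: "j \<in> hom ?F L"
    by (intro homI)
      (auto simp: j_def L_def rational_free_group_def lookup_add in_keys_iff
        simp flip: keys.rep_eq)
  interpret j: group_hom ?F L j by unfold_locales (rule j)
  have inj_j: "c = c'" if "j c = j c'" for c c'
    using that by (intro poly_mapping_eqI) (simp add: j_def fun_eq_iff)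
  define Rel where "Rel = {c \<in> carrier ?F. h c \<in> K}"
  have "subgroup Rel ?F"
    unfolding Rel_def by (rule subgroup.intro) (auto simp: h.hom_inv simp del: carrier_free_Abelian_group_iff mult_free_Abelian_group one_free_Abelian_group)
  then have N: "subgroup (j ` Rel) L" by (rule j.subgroup_img_is_subgroup)
  define N where "N = j ` Rel"
  define D where "D = L Mod N"
  have nN: "N \<lhd> L" using N by (simp add: N_def L.normal_iff_subgroup)
  define \<pi> where "\<pi> = (\<lambda>q. N #>\<^bsub>L\<^esub> q)"
  have divD: "divisible_group D" unfolding D_def N_def by (rule divisible_FactGroup[OF divL N])
  interpret D: comm_group D using divD by (simp add: divisible_group_def)
  have pi: "\<pi> \<in> hom L D" unfolding \<pi>_def D_def by (rule normal.r_coset_hom_Mod[OF nN])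
  interpret pi: group_hom L D \<pi> by unfold_locales (rule pi)
  have ker_pi: "\<pi> q = \<one>\<^bsub>D\<^esub> \<longleftrightarrow> q \<in> N" if "q \<in> carrier L" for q
    using L.coset_join1[of N q] L.coset_join2[of q N] that N
    by (auto simp: \<pi>_def D_def N_def subgroup.subset)
  have ker: "\<pi> (j c) = \<one>\<^bsub>D\<^esub> \<longleftrightarrow> h c \<in> K" if c: "c \<in> carrier ?F" for c
    using ker_pi[OF j.hom_closed[OF c]] c inj_j by (auto simp: N_def Rel_def)
  define \<phi> where "\<phi> = (\<lambda>g. \<pi> (j (frag_of g)))"
  have fo: "frag_of g \<in> carrier ?F" if "g \<in> ?S" for g using that by simp
  have "\<phi> \<in> hom G D"
  proof (rule homI)
    show "\<phi> x \<in> carrier D" if "x \<in> ?S" for x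
      unfolding \<phi>_def by (rule pi.hom_closed[OF j.hom_closed[OF fo[OF that]]])
    fix x y assume x: "x \<in> ?S" and y: "y \<in> ?S"
    let ?s = "frag_of x \<otimes>\<^bsub>?F\<^esub> frag_of y"
    let ?c = "frag_of (x \<otimes>\<^bsub>G\<^esub> y) \<otimes>\<^bsub>?F\<^esub> inv\<^bsub>?F\<^esub> ?s"
    note cl = fo[OF x] fo[OF y] fo[OF G.m_closed[OF x y]]
    have s: "?s \<in> carrier ?F" by (rule F.m_closed[OF cl(1,2)])
    have c: "?c \<in> carrier ?F" by (rule F.m_closed[OF cl(3) F.inv_closed[OF s]])
    \<comment> \<open>Additivity holds because the defect \<open>?c\<close> is one of the relations.\<close>
    have "h ?c = \<one>\<^bsub>G\<^esub>"
      unfolding h.hom_mult[OF cl(3) F.inv_closed[OF s]] h.hom_inv[OF s] h.hom_mult[OF cl(1,2)]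
      using x y by (simp add: h_of)
    then have "\<pi> (j ?c) = \<one>\<^bsub>D\<^esub>" using ker[OF c] by simp
    then have "\<phi> (x \<otimes>\<^bsub>G\<^esub> y) \<otimes>\<^bsub>D\<^esub> inv\<^bsub>D\<^esub> (\<phi> x \<otimes>\<^bsub>D\<^esub> \<phi> y) = \<one>\<^bsub>D\<^esub>"
      unfolding \<phi>_def j.hom_mult[OF cl(3) F.inv_closed[OF s]] j.hom_inv[OF s] j.hom_mult[OF cl(1,2)]
      using j.hom_closed[OF cl(1)] j.hom_closed[OF cl(2)] j.hom_closed[OF cl(3)] by simp
    moreover have "\<phi> x \<in> carrier D" "\<phi> y \<in> carrier D" "\<phi> (x \<otimes>\<^bsub>G\<^esub> y) \<in> carrier D"
      unfolding \<phi>_def using j.hom_closed[OF cl(1)] j.hom_closed[OF cl(2)] j.hom_closed[OF cl(3)] by auto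
    ultimately show "\<phi> (x \<otimes>\<^bsub>G\<^esub> y) = \<phi> x \<otimes>\<^bsub>D\<^esub> \<phi> y"
      using D.inv_equality by fastforce
  qed
  moreover have "kernel G D \<phi> = K"
    unfolding kernel_def \<phi>_def using ker[OF fo] h_of K.subset by auto
  moreover have "carrier D \<lesssim> C"
  proof -
    have "carrier D \<lesssim> carrier L" by (simp add: D_def carrier_FactGroup image_lepoll)
    also have "\<dots> \<lesssim> C" unfolding L_def by (rule rational_free_group_lepoll[OF C]) (use G.one_closed in blast)
    finally show ?thesis .
  qed
  ultimately show ?thesis using that divD by blast
qed


section \<open>Module homomorphisms\<close>

lemma mod_homI:
  assumes "f \<in> carrier M \<rightarrow>\<^sub>E carrier N"
    and "\<And>x y. x \<in> carrier M \<Longrightarrow> y \<in> carrier M \<Longrightarrow> f (x \<oplus>\<^bsub>M\<^esub> y) = f x \<oplus>\<^bsub>N\<^esub> f y"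
    and "\<And>a x. a \<in> carrier R \<Longrightarrow> x \<in> carrier M \<Longrightarrow> f (a \<odot>\<^bsub>M\<^esub> x) = a \<odot>\<^bsub>N\<^esub> f x"
  shows "f \<in> mod_hom R M N"
  using assms by (simp add: mod_hom_def)

lemma mod_homD:
  assumes "f \<in> mod_hom R M N"
  shows "f \<in> carrier M \<rightarrow>\<^sub>E carrier N"
    and "\<And>x. x \<in> carrier M \<Longrightarrow> f x \<in> carrier N"
    and "\<And>x y. x \<in> carrier M \<Longrightarrow> y \<in> carrier M \<Longrightarrow> f (x \<oplus>\<^bsub>M\<^esub> y) = f x \<oplus>\<^bsub>N\<^esub> f y"
    and "\<And>a x. a \<in> carrier R \<Longrightarrow> x \<in> carrier M \<Longrightarrow> f (a \<odot>\<^bsub>M\<^esub> x) = a \<odot>\<^bsub>N\<^esub> f x"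
  using assms by (auto simp: mod_hom_def)

lemma mod_hom_add_hom: "f \<in> mod_hom R M N \<Longrightarrow> f \<in> hom (add_monoid M) (add_monoid N)"
  by (rule homI) (auto dest: mod_homD)

lemma compose_mod_hom:
  assumes "left_module R L" "f \<in> mod_hom R L M" "g \<in> mod_hom R M N"
  shows "compose (carrier L) g f \<in> mod_hom R L N"
proof -
  interpret L: left_module R L by fact
  show ?thesis
    by (rule mod_homI) (auto simp: compose_def mod_homD[OF assms(2)] mod_homD[OF assms(3)] L.smult_closed)
qed

lemma compose_mod_mono:
  assumes "left_module R L" "f \<in> mod_mono R L M" "g \<in> mod_mono R M N"
  shows "compose (carrier L) g f \<in> mod_mono R L N"
  using assms compose_mod_hom[OF assms(1), of f M g N]
  by (auto simp: mod_mono_def inj_on_def compose_def mod_homD)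

lemma left_moduleI:
  assumes "ring R"
    and "\<And>x y. x \<in> carrier M \<Longrightarrow> y \<in> carrier M \<Longrightarrow> x \<oplus>\<^bsub>M\<^esub> y \<in> carrier M"
    and "\<zero>\<^bsub>M\<^esub> \<in> carrier M"
    and "\<And>x y z. x \<in> carrier M \<Longrightarrow> y \<in> carrier M \<Longrightarrow> z \<in> carrier M \<Longrightarrow>
           (x \<oplus>\<^bsub>M\<^esub> y) \<oplus>\<^bsub>M\<^esub> z = x \<oplus>\<^bsub>M\<^esub> (y \<oplus>\<^bsub>M\<^esub> z)"
    and "\<And>x y. x \<in> carrier M \<Longrightarrow> y \<in> carrier M \<Longrightarrow> x \<oplus>\<^bsub>M\<^esub> y = y \<oplus>\<^bsub>M\<^esub> x"
    and "\<And>x. x \<in> carrier M \<Longrightarrow> \<zero>\<^bsub>M\<^esub> \<oplus>\<^bsub>M\<^esub> x = x"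
    and "\<And>x. x \<in> carrier M \<Longrightarrow> \<exists>y\<in>carrier M. y \<oplus>\<^bsub>M\<^esub> x = \<zero>\<^bsub>M\<^esub>"
    and "\<And>a x. a \<in> carrier R \<Longrightarrow> x \<in> carrier M \<Longrightarrow> a \<odot>\<^bsub>M\<^esub> x \<in> carrier M"
    and "\<And>a b x. a \<in> carrier R \<Longrightarrow> b \<in> carrier R \<Longrightarrow> x \<in> carrier M \<Longrightarrow>
           (a \<oplus>\<^bsub>R\<^esub> b) \<odot>\<^bsub>M\<^esub> x = a \<odot>\<^bsub>M\<^esub> x \<oplus>\<^bsub>M\<^esub> b \<odot>\<^bsub>M\<^esub> x"
    and "\<And>a x y. a \<in> carrier R \<Longrightarrow> x \<in> carrier M \<Longrightarrow> y \<in> carrier M \<Longrightarrow>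
           a \<odot>\<^bsub>M\<^esub> (x \<oplus>\<^bsub>M\<^esub> y) = a \<odot>\<^bsub>M\<^esub> x \<oplus>\<^bsub>M\<^esub> a \<odot>\<^bsub>M\<^esub> y"
    and "\<And>a b x. a \<in> carrier R \<Longrightarrow> b \<in> carrier R \<Longrightarrow> x \<in> carrier M \<Longrightarrow>
           (a \<otimes>\<^bsub>R\<^esub> b) \<odot>\<^bsub>M\<^esub> x = a \<odot>\<^bsub>M\<^esub> (b \<odot>\<^bsub>M\<^esub> x)"
    and "\<And>x. x \<in> carrier M \<Longrightarrow> \<one>\<^bsub>R\<^esub> \<odot>\<^bsub>M\<^esub> x = x"
  shows "left_module R M"
  using abelian_groupI[of M] assms
  by (simp add: left_module_def left_module_axioms_def)


section \<open>Enough injective modules\<close>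

text \<open>
  The additive maps from \<open>R\<close> to \<open>D\<close>. Scalars act through multiplication on the right of the
  argument, which turns the right action of \<open>R\<close> on itself into a left action on maps.
\<close>

definition coinduced_module ::
  "('r, 'q) ring_scheme \<Rightarrow> 'd monoid \<Rightarrow> ('r, 'r \<Rightarrow> 'd) module" where
  "coinduced_module R D =
     \<lparr>carrier = {\<theta> \<in> carrier R \<rightarrow>\<^sub>E carrier D. \<forall>r\<in>carrier R. \<forall>s\<in>carrier R. \<theta> (r \<oplus>\<^bsub>R\<^esub> s) = \<theta> r \<otimes>\<^bsub>D\<^esub> \<theta> s},
      monoid.mult = undefined, one = undefined,
      ring.zero = (\<lambda>r\<in>carrier R. \<one>\<^bsub>D\<^esub>),
      ring.add = (\<lambda>\<theta> \<eta>. \<lambda>r\<in>carrier R. \<theta> r \<otimes>\<^bsub>D\<^esub> \<eta> r),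
      module.smult = (\<lambda>a \<theta>. \<lambda>r\<in>carrier R. \<theta> (r \<otimes>\<^bsub>R\<^esub> a))\<rparr>"

lemma left_module_coinduced_module:
  assumes "ring R" "comm_group D"
  shows "left_module R (coinduced_module R D)"
proof -
  interpret R: ring R by fact
  interpret D: comm_group D by fact
  let ?E = "coinduced_module R D"
  have val: "\<theta> r \<in> carrier D" if "\<theta> \<in> carrier ?E" "r \<in> carrier R" for \<theta> r
    using that by (auto simp: coinduced_module_def)
  have ad: "\<theta> (r \<oplus>\<^bsub>R\<^esub> s) = \<theta> r \<otimes>\<^bsub>D\<^esub> \<theta> s" if "\<theta> \<in> carrier ?E" "r \<in> carrier R" "s \<in> carrier R" for \<theta> r s
    using that by (auto simp: coinduced_module_def)
  have ext: "\<theta> = (\<lambda>r\<in>carrier R. \<eta> r)" if "\<theta> \<in> carrier ?E" "\<And>r. r \<in> carrier R \<Longrightarrow> \<theta> r = \<eta> r" for \<theta> \<eta>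
    using that by (auto simp: coinduced_module_def PiE_def extensional_def fun_eq_iff)
  have mem: "(\<lambda>r\<in>carrier R. \<theta> r) \<in> carrier ?E"
    if "\<And>r. r \<in> carrier R \<Longrightarrow> \<theta> r \<in> carrier D"
      "\<And>r s. r \<in> carrier R \<Longrightarrow> s \<in> carrier R \<Longrightarrow> \<theta> (r \<oplus>\<^bsub>R\<^esub> s) = \<theta> r \<otimes>\<^bsub>D\<^esub> \<theta> s" for \<theta>
    using that by (simp add: coinduced_module_def)
  have add: "\<theta> \<oplus>\<^bsub>?E\<^esub> \<eta> = (\<lambda>r\<in>carrier R. \<theta> r \<otimes>\<^bsub>D\<^esub> \<eta> r)" for \<theta> \<eta>
    by (simp add: coinduced_module_def)
  have zero: "\<zero>\<^bsub>?E\<^esub> = (\<lambda>r\<in>carrier R. \<one>\<^bsub>D\<^esub>)" by (simp add: coinduced_module_def)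
  have smult: "a \<odot>\<^bsub>?E\<^esub> \<theta> = (\<lambda>r\<in>carrier R. \<theta> (r \<otimes>\<^bsub>R\<^esub> a))" for a \<theta>
    by (simp add: coinduced_module_def)
  show ?thesis
  proof (rule left_moduleI)
    fix \<theta> assume th: "\<theta> \<in> carrier ?E"
    show "\<exists>\<eta>\<in>carrier ?E. \<eta> \<oplus>\<^bsub>?E\<^esub> \<theta> = \<zero>\<^bsub>?E\<^esub>"
    proof (rule bexI)
      show "(\<lambda>r\<in>carrier R. inv\<^bsub>D\<^esub> \<theta> r) \<in> carrier ?E"
        using th by (intro mem) (auto simp: val ad D.inv_mult)
      show "(\<lambda>r\<in>carrier R. inv\<^bsub>D\<^esub> \<theta> r) \<oplus>\<^bsub>?E\<^esub> \<theta> = \<zero>\<^bsub>?E\<^esub>"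
        unfolding add zero using th by (intro restrict_ext) (auto simp: val)
    qed
    show "\<zero>\<^bsub>?E\<^esub> \<oplus>\<^bsub>?E\<^esub> \<theta> = \<theta>"
      unfolding add zero using th by (intro ext[symmetric]) (auto simp: val)
    show "\<one>\<^bsub>R\<^esub> \<odot>\<^bsub>?E\<^esub> \<theta> = \<theta>"
      unfolding smult using th by (intro ext[symmetric]) (auto simp: val)
    show "a \<odot>\<^bsub>?E\<^esub> \<theta> \<in> carrier ?E" if "a \<in> carrier R" for a
      unfolding smult using th that by (intro mem) (auto simp: val ad R.l_distr)
    show "(a \<oplus>\<^bsub>R\<^esub> b) \<odot>\<^bsub>?E\<^esub> \<theta> = a \<odot>\<^bsub>?E\<^esub> \<theta> \<oplus>\<^bsub>?E\<^esub> b \<odot>\<^bsub>?E\<^esub> \<theta>" if "a \<in> carrier R" "b \<in> carrier R" for a b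
      unfolding smult add using th that by (intro restrict_ext) (auto simp: val ad R.r_distr)
    show "(a \<otimes>\<^bsub>R\<^esub> b) \<odot>\<^bsub>?E\<^esub> \<theta> = a \<odot>\<^bsub>?E\<^esub> (b \<odot>\<^bsub>?E\<^esub> \<theta>)" if "a \<in> carrier R" "b \<in> carrier R" for a b
      unfolding smult using th that by (intro restrict_ext) (auto simp: R.m_assoc)
    fix \<eta> assume et: "\<eta> \<in> carrier ?E"
    show "\<theta> \<oplus>\<^bsub>?E\<^esub> \<eta> \<in> carrier ?E"
      unfolding add using th et by (intro mem) (auto simp: val ad D.m_ac)
    show "\<theta> \<oplus>\<^bsub>?E\<^esub> \<eta> = \<eta> \<oplus>\<^bsub>?E\<^esub> \<theta>"
      unfolding add using th et by (intro restrict_ext) (auto simp: val D.m_comm)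
    show "a \<odot>\<^bsub>?E\<^esub> (\<theta> \<oplus>\<^bsub>?E\<^esub> \<eta>) = a \<odot>\<^bsub>?E\<^esub> \<theta> \<oplus>\<^bsub>?E\<^esub> a \<odot>\<^bsub>?E\<^esub> \<eta>" if "a \<in> carrier R" for a
      unfolding add smult using that by (intro restrict_ext) auto
    fix \<zeta> assume ze: "\<zeta> \<in> carrier ?E"
    show "(\<theta> \<oplus>\<^bsub>?E\<^esub> \<eta>) \<oplus>\<^bsub>?E\<^esub> \<zeta> = \<theta> \<oplus>\<^bsub>?E\<^esub> (\<eta> \<oplus>\<^bsub>?E\<^esub> \<zeta>)"
      unfolding add using th et ze by (intro restrict_ext) (auto simp: val D.m_assoc)
  next
    show "\<zero>\<^bsub>?E\<^esub> \<in> carrier ?E" unfolding zero by (intro mem) auto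
  qed fact
qed

text \<open>
  The universe consists of subsets of one fixed type, in which the coinduced module does not
  live; it is moved there along an injection.
\<close>

definition transport_module :: "('w \<Rightarrow> 'u) \<Rightarrow> ('r, 'w) module \<Rightarrow> ('r, 'u) module" where
  "transport_module e M =
     \<lparr>carrier = e ` carrier M, monoid.mult = undefined, one = undefined,
      ring.zero = e \<zero>\<^bsub>M\<^esub>,
      ring.add = (\<lambda>x y. e (inv_into (carrier M) e x \<oplus>\<^bsub>M\<^esub> inv_into (carrier M) e y)),
      module.smult = (\<lambda>a x. e (a \<odot>\<^bsub>M\<^esub> inv_into (carrier M) e x))\<rparr>"

lemma transport_module_simps:
  "carrier (transport_module e M) = e ` carrier M"
  "\<zero>\<^bsub>transport_module e M\<^esub> = e \<zero>\<^bsub>M\<^esub>"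
  "inj_on e (carrier M) \<Longrightarrow> x \<in> carrier M \<Longrightarrow> y \<in> carrier M \<Longrightarrow>
     e x \<oplus>\<^bsub>transport_module e M\<^esub> e y = e (x \<oplus>\<^bsub>M\<^esub> y)"
  "inj_on e (carrier M) \<Longrightarrow> x \<in> carrier M \<Longrightarrow> a \<odot>\<^bsub>transport_module e M\<^esub> e x = e (a \<odot>\<^bsub>M\<^esub> x)"
  by (simp_all add: transport_module_def)

lemma left_module_transport_module:
  assumes "left_module R M" "inj_on e (carrier M)"
  shows "left_module R (transport_module e M)"
proof -
  interpret M: left_module R M by fact
  note simps = transport_module_simps(1,2) transport_module_simps(3,4)[OF assms(2)]
  show ?thesis
  proof (rule left_moduleI)
    show "\<exists>y\<in>carrier (transport_module e M). y \<oplus>\<^bsub>transport_module e M\<^esub> x = \<zero>\<^bsub>transport_module e M\<^esub>"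
      if x: "x \<in> carrier (transport_module e M)" for x
    proof -
      obtain m where m: "m \<in> carrier M" "x = e m" using x by (auto simp: simps)
      show ?thesis
        by (rule bexI[of _ "e (\<ominus>\<^bsub>M\<^esub> m)"]) (use m in \<open>auto simp: simps M.M.l_neg\<close>)
    qed
  qed (auto simp: simps M.R.ring_axioms M.M.a_ac M.smult_closed M.smult_l_distr
        M.smult_r_distr M.smult_assoc1 M.smult_one)
qed

text \<open>
  A module homomorphism \<open>f\<close> into the coinduced module amounts to the additive map
  \<open>m \<mapsto> f m 1\<close> into \<open>D\<close>: it is recovered as \<open>m \<mapsto> (r \<mapsto> f (r m) 1)\<close>. So extending \<open>f\<close> along \<open>i\<close>
  reduces to extending an additive map into a divisible group. The coinduced module
  has elements of another type than \<open>M\<close> and \<open>N\<close>, which is why \<open>f\<close> is described by its properties and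
  not as a member of \<^const>\<open>mod_hom\<close>.
\<close>

lemma coinduced_module_injective:
  assumes R: "ring R" and D: "divisible_group D"
    and M: "left_module R M" and N: "left_module R N" and i: "i \<in> mod_mono R M N"
    and f: "f \<in> carrier M \<rightarrow> carrier (coinduced_module R D)"
      "\<And>x y. x \<in> carrier M \<Longrightarrow> y \<in> carrier M \<Longrightarrow> f (x \<oplus>\<^bsub>M\<^esub> y) = f x \<oplus>\<^bsub>coinduced_module R D\<^esub> f y"
      "\<And>a x. a \<in> carrier R \<Longrightarrow> x \<in> carrier M \<Longrightarrow> f (a \<odot>\<^bsub>M\<^esub> x) = a \<odot>\<^bsub>coinduced_module R D\<^esub> f x"
  obtains \<gamma> where "\<gamma> \<in> hom (add_monoid N) D"
    "\<And>m. m \<in> carrier M \<Longrightarrow> (\<lambda>r\<in>carrier R. \<gamma> (r \<odot>\<^bsub>N\<^esub> i m)) = f m"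
proof -
  interpret R: ring R by fact
  interpret M: left_module R M by fact
  interpret N: left_module R N by fact
  interpret D: comm_group D using D by (simp add: divisible_group_def)
  have ih: "i \<in> mod_hom R M N" using i by (simp add: mod_mono_def)
  have fx: "f x \<in> carrier R \<rightarrow>\<^sub>E carrier D" if "x \<in> carrier M" for x
    using f(1) that by (auto simp: coinduced_module_def)
  have f1: "(\<lambda>m. f m \<one>\<^bsub>R\<^esub>) \<in> hom (add_monoid M) D"
    by (rule homI) (use fx in \<open>auto simp: f(2), auto simp: coinduced_module_def\<close>)
  have im: "i \<in> mon (add_monoid M) (add_monoid N)"
    using i mod_hom_add_hom[OF ih] by (simp add: mon_def mod_mono_def)
  obtain \<gamma> where \<gamma>: "\<gamma> \<in> hom (add_monoid N) D"
    and \<gamma>_i: "\<And>m. m \<in> carrier M \<Longrightarrow> \<gamma> (i m) = f m \<one>\<^bsub>R\<^esub>"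
    using divisible_group_injective[OF M.M.a_comm_group N.M.a_comm_group D im f1] by auto
  have "(\<lambda>r\<in>carrier R. \<gamma> (r \<odot>\<^bsub>N\<^esub> i m)) = f m" if m: "m \<in> carrier M" for m
  proof
    fix r
    show "(\<lambda>r\<in>carrier R. \<gamma> (r \<odot>\<^bsub>N\<^esub> i m)) r = f m r"
    proof (cases "r \<in> carrier R")
      case True
      then have "\<gamma> (r \<odot>\<^bsub>N\<^esub> i m) = f (r \<odot>\<^bsub>M\<^esub> m) \<one>\<^bsub>R\<^esub>"
        using m by (simp add: M.smult_closed mod_homD(4)[OF ih, symmetric] \<gamma>_i)
      also have "\<dots> = f m r" using True m by (simp add: f(3)) (simp add: coinduced_module_def)
      finally show ?thesis using True by simp
    next
      case False
      then show ?thesis using fx[OF m] by (auto simp: PiE_def extensional_def)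
    qed
  qed
  with \<gamma> show ?thesis by (rule that)
qed

lemma size_closedD: "size_closed U \<Longrightarrow> A \<in> U \<Longrightarrow> B \<lesssim> A \<Longrightarrow> B \<in> U"
  unfolding size_closed_def by blast

text \<open>
  Choose an additive map \<open>\<phi>\<close> from \<open>M\<close> to a divisible group with kernel \<open>K\<close> and send \<open>x\<close> to
  \<open>r \<mapsto> \<phi>(r x)\<close>. The kernel of this homomorphism is the largest submodule contained in the kernel
  of \<open>\<phi>\<close>, which is \<open>K\<close> itself.
\<close>

proposition exists_hom_to_injective_with_kernel:
  fixes R :: "('r, 'q) ring_scheme" and M :: "('r, 'u) module"
  assumes R: "ring R" and U: "module_universe R U" and MU: "M \<in> modules_in R U"
    and K: "subgroup K (add_monoid M)"
    and Ksm: "\<And>a x. a \<in> carrier R \<Longrightarrow> x \<in> K \<Longrightarrow> a \<odot>\<^bsub>M\<^esub> x \<in> K"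
  obtains I p where "injective_module R U I" "p \<in> mod_hom R M I"
    "{x \<in> carrier M. p x = \<zero>\<^bsub>I\<^esub>} = K"
proof -
  interpret R: ring R by fact
  have M: "left_module R M" and cM: "carrier M \<in> U" using MU by (auto simp: modules_in_def)
  interpret M: left_module R M by fact
  have sc: "size_closed U" using U by (simp add: module_universe_def)
  obtain A where A: "A \<in> U" "infinite A" using U by (auto simp: module_universe_def)
  \<comment> \<open>The divisible group need not be as small as a finite \<open>M\<close>, so \<open>M\<close> is first compared with an infinite set.\<close>
  obtain C where C: "C \<in> U" "infinite C" "carrier M \<lesssim> C"
  proof (cases "carrier M \<lesssim> A")
    case True
    then show ?thesis using A that by blast
  next
    case False
    then have "A \<lesssim> carrier M"
      using ordLeq_total[OF card_of_Well_order card_of_Well_order, of "carrier M" A]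
      unfolding lepoll_def card_of_ordLeq by blast
    then have "infinite (carrier M)" using A(2) by (meson infinite_le_lepoll lepoll_trans)
    then show ?thesis using cM that by blast
  qed
  obtain D :: "('u \<Rightarrow> rat) set monoid" and \<phi> where D: "divisible_group D" and DC: "carrier D \<lesssim> C"
    and \<phi>: "\<phi> \<in> hom (add_monoid M) D" and ker: "kernel (add_monoid M) D \<phi> = K"
    using exists_hom_to_divisible_group_with_kernel[OF M.M.a_comm_group K C(2)] C(3) by auto
  interpret D: comm_group D using D by (simp add: divisible_group_def)
  let ?E = "coinduced_module R D"
  have E: "left_module R ?E" by (rule left_module_coinduced_module[OF R D.comm_group_axioms])
  interpret E: left_module R ?E by fact
  obtain B where B: "B \<in> U" "(carrier R \<rightarrow>\<^sub>E C) \<lesssim> B"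
    using U C(1) unfolding module_universe_def by blast
  have "carrier ?E \<lesssim> carrier R \<rightarrow>\<^sub>E carrier D"
    by (rule subset_imp_lepoll) (auto simp: coinduced_module_def)
  also have "\<dots> \<lesssim> carrier R \<rightarrow>\<^sub>E C" by (rule lepoll_funcset_right[OF DC])
  also have "\<dots> \<lesssim> B" by (rule B(2))
  finally obtain e where e: "inj_on e (carrier ?E)" "e ` carrier ?E \<subseteq> B"
    by (auto simp: lepoll_def)
  define I where "I = transport_module e ?E"
  have I: "left_module R I" unfolding I_def by (rule left_module_transport_module[OF E e(1)])
  note simps = transport_module_simps(1,2)[of e ?E, folded I_def]
    transport_module_simps(3,4)[OF e(1), folded I_def]
  have IU: "I \<in> modules_in R U"
    using I size_closedD[OF sc B(1) subset_imp_lepoll[OF e(2)]] by (simp add: modules_in_def simps)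
  have coind: "(\<lambda>r\<in>carrier R. \<gamma> (r \<odot>\<^bsub>N\<^esub> x)) \<in> carrier ?E"
    and lin: "(\<lambda>x\<in>carrier N. e (\<lambda>r\<in>carrier R. \<gamma> (r \<odot>\<^bsub>N\<^esub> x))) \<in> mod_hom R N I"
    if N: "left_module R N" and \<gamma>: "\<gamma> \<in> hom (add_monoid N) D" and x: "x \<in> carrier N"
    for N :: "('r, 'u) module" and \<gamma> x
  proof -
    interpret N: left_module R N by fact
    have \<gamma>c: "\<gamma> x \<in> carrier D" if "x \<in> carrier N" for x using \<gamma> that by (auto simp: hom_def)
    have \<gamma>a: "\<gamma> (x \<oplus>\<^bsub>N\<^esub> y) = \<gamma> x \<otimes>\<^bsub>D\<^esub> \<gamma> y" if "x \<in> carrier N" "y \<in> carrier N" for x y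
      using \<gamma> that by (auto simp: hom_def)
    have *: "(\<lambda>r\<in>carrier R. \<gamma> (r \<odot>\<^bsub>N\<^esub> x)) \<in> carrier ?E" if "x \<in> carrier N" for x
      using that by (simp add: coinduced_module_def N.smult_closed \<gamma>c \<gamma>a N.smult_l_distr)
    show "(\<lambda>r\<in>carrier R. \<gamma> (r \<odot>\<^bsub>N\<^esub> x)) \<in> carrier ?E" using * x .
    have add: "(\<lambda>r\<in>carrier R. \<gamma> (r \<odot>\<^bsub>N\<^esub> (x \<oplus>\<^bsub>N\<^esub> y)))
        = (\<lambda>r\<in>carrier R. \<gamma> (r \<odot>\<^bsub>N\<^esub> x)) \<oplus>\<^bsub>?E\<^esub> (\<lambda>r\<in>carrier R. \<gamma> (r \<odot>\<^bsub>N\<^esub> y))"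
      if "x \<in> carrier N" "y \<in> carrier N" for x y
      using that by (auto simp: coinduced_module_def N.smult_closed \<gamma>a N.smult_r_distr intro!: restrict_ext)
    have smu: "(\<lambda>r\<in>carrier R. \<gamma> (r \<odot>\<^bsub>N\<^esub> (a \<odot>\<^bsub>N\<^esub> x))) = a \<odot>\<^bsub>?E\<^esub> (\<lambda>r\<in>carrier R. \<gamma> (r \<odot>\<^bsub>N\<^esub> x))"
      if "a \<in> carrier R" "x \<in> carrier N" for a x
      using that by (auto simp: coinduced_module_def N.smult_assoc1 intro!: restrict_ext)
    show "(\<lambda>x\<in>carrier N. e (\<lambda>r\<in>carrier R. \<gamma> (r \<odot>\<^bsub>N\<^esub> x))) \<in> mod_hom R N I"
      by (rule mod_homI) (auto simp: simps * N.smult_closed add smu)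
  qed
  have "injective_module R U I"
    unfolding injective_module_def
  proof (intro conjI ballI)
    show "I \<in> modules_in R U" by (rule IU)
    fix M' N' i f
    assume M'U: "M' \<in> modules_in R U" and N'U: "N' \<in> modules_in R U"
      and i: "i \<in> mod_mono R M' N'" and f: "f \<in> mod_hom R M' I"
    have M': "left_module R M'" and N': "left_module R N'" using M'U N'U by (auto simp: modules_in_def)
    interpret M': left_module R M' by fact
    have ih: "i \<in> mod_hom R M' N'" using i by (simp add: mod_mono_def)
    define f' where "f' = (\<lambda>m. inv_into (carrier ?E) e (f m))"
    have f'c: "f' m \<in> carrier ?E" and ef': "e (f' m) = f m" if "m \<in> carrier M'" for m
      using mod_homD(2)[OF f that] by (auto simp: f'_def simps inv_into_f_f[OF e(1)])
    have f'a: "f' (x \<oplus>\<^bsub>M'\<^esub> y) = f' x \<oplus>\<^bsub>?E\<^esub> f' y" if xy: "x \<in> carrier M'" "y \<in> carrier M'" for x y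
    proof (rule inj_onD[OF e(1)])
      show "e (f' (x \<oplus>\<^bsub>M'\<^esub> y)) = e (f' x \<oplus>\<^bsub>?E\<^esub> f' y)"
        using xy by (simp add: ef' mod_homD(3)[OF f] f'c simps(3)[symmetric])
    qed (use xy f'c in auto)
    have f's: "f' (a \<odot>\<^bsub>M'\<^esub> x) = a \<odot>\<^bsub>?E\<^esub> f' x" if ax: "a \<in> carrier R" "x \<in> carrier M'" for a x
    proof (rule inj_onD[OF e(1)])
      show "e (f' (a \<odot>\<^bsub>M'\<^esub> x)) = e (a \<odot>\<^bsub>?E\<^esub> f' x)"
        using ax by (simp add: ef' mod_homD(4)[OF f] f'c simps(4)[symmetric] M'.smult_closed)
    qed (use ax f'c in \<open>auto simp: M'.smult_closed E.smult_closed\<close>)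
    obtain \<gamma> where \<gamma>: "\<gamma> \<in> hom (add_monoid N') D"
      and \<gamma>_i: "\<And>m. m \<in> carrier M' \<Longrightarrow> (\<lambda>r\<in>carrier R. \<gamma> (r \<odot>\<^bsub>N'\<^esub> i m)) = f' m"
      using coinduced_module_injective[OF R D M' N' i _ f'a f's] f'c by blast
    define g where "g = (\<lambda>x\<in>carrier N'. e (\<lambda>r\<in>carrier R. \<gamma> (r \<odot>\<^bsub>N'\<^esub> x)))"
    have "i \<zero>\<^bsub>M'\<^esub> \<in> carrier N'" using mod_homD(2)[OF ih] by simp
    then have "g \<in> mod_hom R N' I" unfolding g_def by (rule lin[OF N' \<gamma>])
    moreover have "compose (carrier M') g i = f"
    proof
      fix m
      show "compose (carrier M') g i m = f m"
        using mod_homD(1,2)[OF ih] mod_homD(1)[OF f] 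
        by (cases "m \<in> carrier M'") (auto simp: compose_def g_def \<gamma>_i ef' PiE_def extensional_def)
    qed
    ultimately show "\<exists>g\<in>mod_hom R N' I. compose (carrier M') g i = f" by blast
  qed
  moreover define p where "p = (\<lambda>x\<in>carrier M. e (\<lambda>r\<in>carrier R. \<phi> (r \<odot>\<^bsub>M\<^esub> x)))"
  have p: "p \<in> mod_hom R M I" unfolding p_def by (rule lin[OF M \<phi> M.M.zero_closed])
  moreover have "p x = \<zero>\<^bsub>I\<^esub> \<longleftrightarrow> x \<in> K" if x: "x \<in> carrier M" for x
  proof -
    have "p x = \<zero>\<^bsub>I\<^esub> \<longleftrightarrow> (\<lambda>r\<in>carrier R. \<phi> (r \<odot>\<^bsub>M\<^esub> x)) = \<zero>\<^bsub>?E\<^esub>"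
      using x coind[OF M \<phi> x] by (simp add: p_def simps inj_on_eq_iff[OF e(1)])
    also have "\<dots> \<longleftrightarrow> (\<forall>r\<in>carrier R. \<phi> (r \<odot>\<^bsub>M\<^esub> x) = \<one>\<^bsub>D\<^esub>)"
      by (auto simp: coinduced_module_def fun_eq_iff restrict_def)
    also have "\<dots> \<longleftrightarrow> (\<forall>r\<in>carrier R. r \<odot>\<^bsub>M\<^esub> x \<in> K)"
      using x by (auto simp: ker[symmetric] kernel_def M.smult_closed)
    also have "\<dots> \<longleftrightarrow> x \<in> K" using Ksm M.smult_one[OF x] by (metis R.one_closed)
    finally show ?thesis .
  qed
  moreover have "K \<subseteq> carrier M" using subgroup.subset[OF K] by simp
  ultimately show ?thesis by (intro that) auto
qed

lemma exists_inj_copresentation: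
  assumes R: "ring R" and U: "module_universe R U" and BU: "B \<in> modules_in R U"
  shows "\<exists>c. is_inj_copresentation R U B c"
proof -
  have B: "left_module R B" using BU by (simp add: modules_in_def)
  interpret B: left_module R B by fact
  obtain I0 \<iota> where I0: "injective_module R U I0" and \<iota>: "\<iota> \<in> mod_hom R B I0"
    and ker: "{x \<in> carrier B. \<iota> x = \<zero>\<^bsub>I0\<^esub>} = {\<zero>\<^bsub>B\<^esub>}"
  proof (rule exists_hom_to_injective_with_kernel[OF R U BU])
    show "subgroup {\<zero>\<^bsub>B\<^esub>} (add_monoid B)" using B.M.add.triv_subgroup by simp
    show "a \<odot>\<^bsub>B\<^esub> x \<in> {\<zero>\<^bsub>B\<^esub>}" if "a \<in> carrier R" "x \<in> {\<zero>\<^bsub>B\<^esub>}" for a x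
    proof -
      have "a \<odot>\<^bsub>B\<^esub> \<zero>\<^bsub>B\<^esub> \<oplus>\<^bsub>B\<^esub> a \<odot>\<^bsub>B\<^esub> \<zero>\<^bsub>B\<^esub> = a \<odot>\<^bsub>B\<^esub> \<zero>\<^bsub>B\<^esub>"
        using that B.smult_r_distr[of a "\<zero>\<^bsub>B\<^esub>" "\<zero>\<^bsub>B\<^esub>"] by simp
      then show ?thesis using that B.smult_closed[of a "\<zero>\<^bsub>B\<^esub>"] by simp
    qed
  qed
  have I0U: "I0 \<in> modules_in R U" using I0 by (simp add: injective_module_def)
  then have I0m: "left_module R I0" by (simp add: modules_in_def)
  interpret I0: left_module R I0 by fact
  interpret \<iota>: group_hom "add_monoid B" "add_monoid I0" \<iota>
    using mod_hom_add_hom[OF \<iota>] by unfold_locales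
  have "inj_on \<iota> (carrier B)"
    using \<iota>.inj_iff_trivial_ker ker by (simp add: kernel_def)
  then have \<iota>m: "\<iota> \<in> mod_mono R B I0" using \<iota> by (simp add: mod_mono_def)
  obtain I1 \<delta> where I1: "injective_module R U I1" and \<delta>: "\<delta> \<in> mod_hom R I0 I1"
    and ker1: "{x \<in> carrier I0. \<delta> x = \<zero>\<^bsub>I1\<^esub>} = \<iota> ` carrier B"
  proof (rule exists_hom_to_injective_with_kernel[OF R U I0U])
    show "subgroup (\<iota> ` carrier B) (add_monoid I0)" using \<iota>.img_is_subgroup by simp
    show "a \<odot>\<^bsub>I0\<^esub> x \<in> \<iota> ` carrier B" if "a \<in> carrier R" "x \<in> \<iota> ` carrier B" for a x
      using that mod_homD(4)[OF \<iota>, symmetric] B.smult_closed by auto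
  qed
  show ?thesis
    by (rule exI[of _ "\<lparr>cp_I0 = I0, cp_I1 = I1, cp_iota = \<iota>, cp_del = \<delta>\<rparr>"])
      (simp add: is_inj_copresentation_def I0 I1 \<iota>m \<delta> ker1)
qed


section \<open>Additive functors and natural transformations\<close>

lemma additive_functorD:
  assumes "F \<in> additive_functors R U V" "M \<in> modules_in R U"
  shows additive_functor_group: "comm_group (fob F M)"
    and additive_functor_size: "carrier (fob F M) \<in> V"
    and additive_functor_id: "x \<in> carrier (fob F M) \<Longrightarrow> fmap F M M (\<lambda>m\<in>carrier M. m) x = x"
  using assms by (auto simp: additive_functors_def)

lemma additive_functor_hom:
  assumes "F \<in> additive_functors R U V" "M \<in> modules_in R U" "N \<in> modules_in R U" "f \<in> mod_hom R M N"
  shows "fmap F M N f \<in> hom (fob F M) (fob F N)"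
  using assms by (auto simp: additive_functors_def)

lemma additive_functor_comp:
  assumes "F \<in> additive_functors R U V" "L \<in> modules_in R U" "M \<in> modules_in R U" "N \<in> modules_in R U"
    "f \<in> mod_hom R L M" "g \<in> mod_hom R M N" "x \<in> carrier (fob F L)"
  shows "fmap F M N g (fmap F L M f x) = fmap F L N (compose (carrier L) g f) x"
  using assms by (auto simp: additive_functors_def)

lemma additive_functor_add:
  assumes "F \<in> additive_functors R U V" "M \<in> modules_in R U" "N \<in> modules_in R U"
    "f \<in> mod_hom R M N" "g \<in> mod_hom R M N" "x \<in> carrier (fob F M)"
  shows "fmap F M N (\<lambda>m\<in>carrier M. f m \<oplus>\<^bsub>N\<^esub> g m) x
          = fmap F M N f x \<otimes>\<^bsub>fob F N\<^esub> fmap F M N g x"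
  using assms by (auto simp: additive_functors_def)

lemma additive_functor_closed:
  assumes "F \<in> additive_functors R U V" "M \<in> modules_in R U" "N \<in> modules_in R U" "f \<in> mod_hom R M N"
    "x \<in> carrier (fob F M)"
  shows "fmap F M N f x \<in> carrier (fob F N)"
  using hom_in_carrier[OF additive_functor_hom[OF assms(1-4)] assms(5)] .

lemma additive_functor_one:
  assumes "F \<in> additive_functors R U V" "M \<in> modules_in R U" "N \<in> modules_in R U" "f \<in> mod_hom R M N"
  shows "fmap F M N f \<one>\<^bsub>fob F M\<^esub> = \<one>\<^bsub>fob F N\<^esub>"
  by (rule hom_one[OF additive_functor_hom[OF assms]])
    (use assms in \<open>auto intro: comm_group.axioms additive_functor_group\<close>)

lemma id_mod_hom: "left_module R M \<Longrightarrow> (\<lambda>m\<in>carrier M. m) \<in> mod_hom R M M"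
  by (rule mod_homI) (auto simp: left_module_def left_module_axioms_def abelian_group.axioms
      intro: abelian_monoid.a_closed)

lemma add_mod_hom:
  assumes "left_module R M" "left_module R N" "f \<in> mod_hom R M N" "g \<in> mod_hom R M N"
  shows "(\<lambda>m\<in>carrier M. f m \<oplus>\<^bsub>N\<^esub> g m) \<in> mod_hom R M N"
proof -
  interpret M: left_module R M by fact
  interpret N: left_module R N by fact
  show ?thesis
    by (rule mod_homI)
      (auto simp: mod_homD[OF assms(3)] mod_homD[OF assms(4)] M.smult_closed N.smult_r_distr N.M.a_ac)
qed

lemma nat_transfD:
  assumes "\<eta> \<in> nat_transf R U F G" "M \<in> modules_in R U"
  shows nat_transf_hom: "\<eta> M \<in> hom (fob F M) (fob G M)"
    and nat_transf_closed: "x \<in> carrier (fob F M) \<Longrightarrow> \<eta> M x \<in> carrier (fob G M)"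
    and nat_transf_natural: "N \<in> modules_in R U \<Longrightarrow> f \<in> mod_hom R M N \<Longrightarrow> x \<in> carrier (fob F M) \<Longrightarrow>
          \<eta> N (fmap F M N f x) = fmap G M N f (\<eta> M x)"
  using assms by (auto simp: nat_transf_def hom_def)

lemma nat_transf_one:
  assumes "F \<in> additive_functors R U V" "G \<in> additive_functors R U V'"
    "\<eta> \<in> nat_transf R U F G" "M \<in> modules_in R U"
  shows "\<eta> M \<one>\<^bsub>fob F M\<^esub> = \<one>\<^bsub>fob G M\<^esub>"
  by (rule hom_one[OF nat_transf_hom[OF assms(3,4)]])
    (use assms in \<open>auto intro: comm_group.axioms additive_functor_group\<close>)

lemma comm_group_subgroup:
  assumes "comm_group G" "subgroup H G"
  shows "comm_group (G\<lparr>carrier := H\<rparr>)"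
proof -
  interpret comm_group G by fact
  interpret subgroup H G by fact
  show ?thesis
    using subset by (intro group.group_comm_groupI subgroup_imp_group assms(2)) (auto intro: m_comm)
qed

lemma subfunctor_additive:
  assumes F: "F \<in> additive_functors R U V" and V: "size_closed V"
    and sub: "\<And>M. M \<in> modules_in R U \<Longrightarrow> subgroup (S M) (fob F M)"
    and stable: "\<And>M N f x. M \<in> modules_in R U \<Longrightarrow> N \<in> modules_in R U \<Longrightarrow> f \<in> mod_hom R M N \<Longrightarrow>
      x \<in> S M \<Longrightarrow> fmap F M N f x \<in> S N"
  shows "\<lparr>fob = (\<lambda>M. (fob F M)\<lparr>carrier := S M\<rparr>), fmap = fmap F\<rparr> \<in> additive_functors R U V"
proof -
  have S: "x \<in> carrier (fob F M)" if "M \<in> modules_in R U" "x \<in> S M" for x M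
    using subgroup.subset[OF sub[OF that(1)]] that(2) by blast
  have "comm_group ((fob F M)\<lparr>carrier := S M\<rparr>)" if "M \<in> modules_in R U" for M
    using comm_group_subgroup[OF additive_functor_group[OF F that] sub[OF that]] .
  moreover have "S M \<in> V" if M: "M \<in> modules_in R U" for M
    by (rule size_closedD[OF V additive_functor_size[OF F M] subset_imp_lepoll]) (use S[OF M] in blast)
  moreover have "fmap F M N f \<in> hom ((fob F M)\<lparr>carrier := S M\<rparr>) ((fob F N)\<lparr>carrier := S N\<rparr>)"
    if "M \<in> modules_in R U" "N \<in> modules_in R U" "f \<in> mod_hom R M N" for M N f
    using that S[OF that(1)] stable[OF that] additive_functor_hom[OF F that] by (auto simp: hom_def)
  ultimately show ?thesis
    using F S by (auto simp: additive_functors_def)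
qed


section \<open>Torsion elements of an additive functor\<close>

text \<open>
  A ring together with a universe in which it has enough injective modules.
\<close>

locale module_category =
  fixes R :: "('r, 'q) ring_scheme" and U :: "'u set set"
  assumes ring: "ring R" and universe: "module_universe R U"
begin

abbreviation I0 :: "('r, 'u) module \<Rightarrow> ('r, 'u) module" where
  "I0 B \<equiv> cp_I0 (inj_copresentation R U B)"

abbreviation \<iota> :: "('r, 'u) module \<Rightarrow> 'u \<Rightarrow> 'u" where
  "\<iota> B \<equiv> cp_iota (inj_copresentation R U B)"

lemma inj_copresentation:
  assumes "B \<in> modules_in R U"
  shows "is_inj_copresentation R U B (inj_copresentation R U B)"
  unfolding inj_copresentation_def
  by (rule someI_ex) (rule exists_inj_copresentation[OF ring universe assms])

lemma
  assumes "B \<in> modules_in R U"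
  shows I0_injective: "injective_module R U (I0 B)"
    and I0_in: "I0 B \<in> modules_in R U"
    and \<iota>_mono: "\<iota> B \<in> mod_mono R B (I0 B)"
    and \<iota>_hom: "\<iota> B \<in> mod_hom R B (I0 B)"
  using inj_copresentation[OF assms]
  by (auto simp: is_inj_copresentation_def injective_module_def mod_mono_def)

lemma inj_lift:
  assumes B: "B \<in> modules_in R U" and C: "C \<in> modules_in R U" and f: "f \<in> mod_hom R B C"
  shows "inj_lift R U B C f \<in> mod_hom R (I0 B) (I0 C)"
    and "compose (carrier B) (inj_lift R U B C f) (\<iota> B) = compose (carrier B) (\<iota> C) f"
proof -
  have "compose (carrier B) (\<iota> C) f \<in> mod_hom R B (I0 C)"
    using B by (intro compose_mod_hom[OF _ f \<iota>_hom[OF C]]) (simp add: modules_in_def)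
  then have "\<exists>g. g \<in> mod_hom R (I0 B) (I0 C) \<and> compose (carrier B) g (\<iota> B) = compose (carrier B) (\<iota> C) f"
    using I0_injective[OF C] B I0_in[OF B] \<iota>_mono[OF B] unfolding injective_module_def by blast
  from someI_ex[OF this]
  show "inj_lift R U B C f \<in> mod_hom R (I0 B) (I0 C)"
    and "compose (carrier B) (inj_lift R U B C f) (\<iota> B) = compose (carrier B) (\<iota> C) f"
    by (simp_all add: inj_lift_def)
qed

lemma rho_natural:
  assumes F: "F \<in> additive_functors R U V" and B: "B \<in> modules_in R U" and C: "C \<in> modules_in R U"
    and f: "f \<in> mod_hom R B C" and x: "x \<in> carrier (fob F B)"
  shows "fmap (R0 R U F) B C f (rho R U F B x) = rho R U F C (fmap F B C f x)"
  using x additive_functor_comp[OF F B I0_in[OF B] I0_in[OF C] \<iota>_hom[OF B] inj_lift(1)[OF B C f]]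
    additive_functor_comp[OF F B C I0_in[OF C] f \<iota>_hom[OF C]] inj_lift(2)[OF B C f]
  by (simp add: R0_def rho_def Let_def)

lemma rho_hom:
  assumes "F \<in> additive_functors R U V" "B \<in> modules_in R U"
  shows "rho R U F B \<in> hom (fob F B) (fob F (I0 B))"
  using additive_functor_hom[OF assms I0_in \<iota>_hom] assms(2) by (simp add: rho_def Let_def)

lemma rho_group_hom:
  assumes "F \<in> additive_functors R U V" "B \<in> modules_in R U"
  shows "group_hom (fob F B) (fob F (I0 B)) (rho R U F B)"
  unfolding group_hom_def group_hom_axioms_def
  using assms rho_hom I0_in by (auto intro!: comm_group.axioms(2) additive_functor_group)

text \<open>
  Any map from \<open>B\<close> to an injective module factors through the monomorphism \<open>j\<close>, in particular the
  embedding that defines \<open>\<rho>\<close>.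
\<close>

lemma rho_eq_one_if_killed_by_mono:
  assumes F: "F \<in> additive_functors R U V" and B: "B \<in> modules_in R U" and N: "N \<in> modules_in R U"
    and j: "j \<in> mod_mono R B N" and x: "x \<in> carrier (fob F B)"
    and killed: "fmap F B N j x = \<one>\<^bsub>fob F N\<^esub>"
  shows "rho R U F B x = \<one>\<^bsub>fob F (I0 B)\<^esub>"
proof -
  obtain g where g: "g \<in> mod_hom R N (I0 B)" "compose (carrier B) g j = \<iota> B"
    using I0_injective[OF B] B N j \<iota>_hom[OF B] unfolding injective_module_def by blast
  have "rho R U F B x = fmap F N (I0 B) g (fmap F B N j x)"
    using additive_functor_comp[OF F B N I0_in[OF B] _ g(1) x, of j] j g(2)
    by (simp add: rho_def Let_def mod_mono_def)
  then show ?thesis by (simp add: killed additive_functor_one[OF F N I0_in[OF B] g(1)])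
qed

lemma fob_inj_stabilization:
  "fob (inj_stabilization R U F) B
     = (fob F B)\<lparr>carrier := {x \<in> carrier (fob F B). rho R U F B x = \<one>\<^bsub>fob F (I0 B)\<^esub>}\<rparr>"
  by (simp add: inj_stabilization_def ker_functor_def kernel_def R0_def Let_def)

lemma fmap_inj_stabilization: "fmap (inj_stabilization R U F) = fmap F"
  by (simp add: inj_stabilization_def ker_functor_def)

text \<open>
  The injective stabilization consists of the elements that \<open>\<rho>\<close> kills, with the operations of \<open>F\<close>,
  so its inclusion is an isomorphism exactly when these are all elements.
\<close>

lemma injectively_stable_iff:
  assumes F: "F \<in> additive_functors R U V"
  shows "F \<in> injectively_stable_functors R U V \<longleftrightarrow>
    (\<forall>B\<in>modules_in R U. \<forall>x\<in>carrier (fob F B). rho R U F B x = \<one>\<^bsub>fob F (I0 B)\<^esub>)" (is "_ \<longleftrightarrow> ?r")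
proof
  assume "F \<in> injectively_stable_functors R U V"
  then have "(\<lambda>x. x) \<in> iso (fob (inj_stabilization R U F) B) (fob F B)" if "B \<in> modules_in R U" for B
    using that by (auto simp: injectively_stable_functors_def nat_iso_def)
  then show ?r by (auto simp: iso_def bij_betw_def fob_inj_stabilization)
next
  assume ?r
  then show "F \<in> injectively_stable_functors R U V"
    using F by (auto simp: injectively_stable_functors_def nat_iso_def nat_transf_def iso_def hom_def
        bij_betw_def fob_inj_stabilization fmap_inj_stabilization)
qed

lemma injectively_stable_subset: "injectively_stable_functors R U V \<subseteq> additive_functors R U V"
  by (auto simp: injectively_stable_functors_def)

lemma mono_preserving_subset: "mono_preserving_functors R U V \<subseteq> additive_functors R U V"
  by (auto simp: mono_preserving_functors_def)

lemma mono_preservingD: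
  assumes "F \<in> mono_preserving_functors R U V" "M \<in> modules_in R U" "N \<in> modules_in R U" "f \<in> mod_mono R M N"
    "x \<in> carrier (fob F M)" "fmap F M N f x = \<one>\<^bsub>fob F N\<^esub>"
  shows "x = \<one>\<^bsub>fob F M\<^esub>"
proof -
  have F: "F \<in> additive_functors R U V" using assms(1) mono_preserving_subset by blast
  interpret M: comm_group "fob F M" by (rule additive_functor_group[OF F assms(2)])
  have "inj_on (fmap F M N f) (carrier (fob F M))"
    using assms(1-4) by (auto simp: mono_preserving_functors_def mon_def)
  moreover have "fmap F M N f x = fmap F M N f \<one>\<^bsub>fob F M\<^esub>"
    using assms additive_functor_one[OF F assms(2,3)] by (simp add: mod_mono_def)
  ultimately show ?thesis using assms(5) by (auto dest: inj_onD)
qed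

lemma mono_preservingI:
  assumes F: "F \<in> additive_functors R U V"
    and *: "\<And>M N f x. M \<in> modules_in R U \<Longrightarrow> N \<in> modules_in R U \<Longrightarrow> f \<in> mod_mono R M N \<Longrightarrow>
      x \<in> carrier (fob F M) \<Longrightarrow> fmap F M N f x = \<one>\<^bsub>fob F N\<^esub> \<Longrightarrow> x = \<one>\<^bsub>fob F M\<^esub>"
  shows "F \<in> mono_preserving_functors R U V"
proof -
  have "fmap F M N f \<in> mon (fob F M) (fob F N)"
    if M: "M \<in> modules_in R U" and N: "N \<in> modules_in R U" and f: "f \<in> mod_mono R M N" for M N f
  proof -
    have h: "fmap F M N f \<in> hom (fob F M) (fob F N)"
      using additive_functor_hom[OF F M N] f by (simp add: mod_mono_def)
    interpret group_hom "fob F M" "fob F N" "fmap F M N f"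
      using h F M N by (auto simp: group_hom_def group_hom_axioms_def
          intro: comm_group.axioms additive_functor_group)
    show ?thesis using h *[OF M N f] by (auto simp: mon_def inj_on_one_iff)
  qed
  then show ?thesis using F by (simp add: mono_preserving_functors_def)
qed


section \<open>Closure properties of the two classes\<close>

text \<open>
  By naturality the image of a torsion element is killed by the monomorphism \<open>\<iota>\<close>, and \<open>Y\<close>
  takes \<open>\<iota>\<close> to an injective map.
\<close>

lemma nat_transf_torsion_torsionfree_zero:
  assumes T: "T \<in> injectively_stable_functors R U V" and Y: "Y \<in> mono_preserving_functors R U V"
    and \<eta>: "\<eta> \<in> nat_transf R U T Y"
  shows "nat_zero R U T Y \<eta>"
  unfolding nat_zero_def
proof (intro ballI)
  fix B x assume B: "B \<in> modules_in R U" and x: "x \<in> carrier (fob T B)"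
  have Ta: "T \<in> additive_functors R U V" using T injectively_stable_subset by blast
  have Ya: "Y \<in> additive_functors R U V" using Y mono_preserving_subset by blast
  have "rho R U T B x = \<one>\<^bsub>fob T (I0 B)\<^esub>" using T B x injectively_stable_iff[OF Ta] by blast
  then have "fmap Y B (I0 B) (\<iota> B) (\<eta> B x) = \<one>\<^bsub>fob Y (I0 B)\<^esub>"
    using nat_transf_natural[OF \<eta> B I0_in[OF B] \<iota>_hom[OF B] x] nat_transf_one[OF Ta Ya \<eta> I0_in[OF B]]
    by (simp add: rho_def Let_def)
  then show "\<eta> B x = \<one>\<^bsub>fob Y B\<^esub>"
    using mono_preservingD[OF Y B I0_in[OF B] \<iota>_mono[OF B]] nat_transf_closed[OF \<eta> B x] by blast
qed

lemma injectively_stable_subobject: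
  assumes T: "T \<in> injectively_stable_functors R U V" and S: "S \<in> additive_functors R U V"
    and \<eta>: "\<eta> \<in> nat_mono R U S T"
  shows "S \<in> injectively_stable_functors R U V"
  unfolding injectively_stable_iff[OF S]
proof (intro ballI)
  fix B x assume B: "B \<in> modules_in R U" and x: "x \<in> carrier (fob S B)"
  have Ta: "T \<in> additive_functors R U V" using T injectively_stable_subset by blast
  have \<eta>n: "\<eta> \<in> nat_transf R U S T" using \<eta> by (simp add: nat_mono_def)
  have inj: "inj_on (\<eta> (I0 B)) (carrier (fob S (I0 B)))"
    using \<eta> I0_in[OF B] by (auto simp: nat_mono_def mon_def)
  have "rho R U T B (\<eta> B x) = \<one>\<^bsub>fob T (I0 B)\<^esub>"
    using T B nat_transf_closed[OF \<eta>n B x] injectively_stable_iff[OF Ta] by blast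
  then have "\<eta> (I0 B) (rho R U S B x) = \<eta> (I0 B) \<one>\<^bsub>fob S (I0 B)\<^esub>"
    using nat_transf_natural[OF \<eta>n B I0_in[OF B] \<iota>_hom[OF B] x] nat_transf_one[OF S Ta \<eta>n I0_in[OF B]]
    by (simp add: rho_def Let_def)
  moreover interpret group_hom "fob S B" "fob S (I0 B)" "rho R U S B" by (rule rho_group_hom[OF S B])
  show "rho R U S B x = \<one>\<^bsub>fob S (I0 B)\<^esub>"
    using inj_onD[OF inj calculation] x by simp
qed

text \<open>
  Componentwise surjective transformations suffice, because the image of a torsion element is
  torsion; closure under isomorphism is the case of interest.
\<close>

lemma injectively_stable_quotient:
  assumes T: "T \<in> injectively_stable_functors R U V" and Q: "Q \<in> additive_functors R U V"
    and \<eta>: "\<eta> \<in> nat_transf R U T Q"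
    and surj: "\<And>B. B \<in> modules_in R U \<Longrightarrow> \<eta> B ` carrier (fob T B) = carrier (fob Q B)"
  shows "Q \<in> injectively_stable_functors R U V"
  unfolding injectively_stable_iff[OF Q]
proof (intro ballI)
  fix B y assume B: "B \<in> modules_in R U" and "y \<in> carrier (fob Q B)"
  then obtain x where x: "x \<in> carrier (fob T B)" "y = \<eta> B x" using surj[OF B] by blast
  have Ta: "T \<in> additive_functors R U V" using T injectively_stable_subset by blast
  have "rho R U T B x = \<one>\<^bsub>fob T (I0 B)\<^esub>" using T B x injectively_stable_iff[OF Ta] by blast
  then show "rho R U Q B y = \<one>\<^bsub>fob Q (I0 B)\<^esub>"
    using nat_transf_natural[OF \<eta> B I0_in[OF B] \<iota>_hom[OF B] x(1)] x(2)
      nat_transf_one[OF Ta Q \<eta> I0_in[OF B]]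
    by (simp add: rho_def Let_def)
qed

lemma mono_preserving_iso:
  assumes F: "F \<in> mono_preserving_functors R U V" and G: "G \<in> additive_functors R U V"
    and \<eta>: "\<eta> \<in> nat_iso R U F G"
  shows "G \<in> mono_preserving_functors R U V"
proof (rule mono_preservingI[OF G])
  fix M N f y
  assume M: "M \<in> modules_in R U" and N: "N \<in> modules_in R U" and f: "f \<in> mod_mono R M N"
    and y: "y \<in> carrier (fob G M)" and k: "fmap G M N f y = \<one>\<^bsub>fob G N\<^esub>"
  have Fa: "F \<in> additive_functors R U V" using F mono_preserving_subset by blast
  have \<eta>n: "\<eta> \<in> nat_transf R U F G" using \<eta> by (simp add: nat_iso_def)
  have fh: "f \<in> mod_hom R M N" using f by (simp add: mod_mono_def)
  obtain x where x: "x \<in> carrier (fob F M)" "y = \<eta> M x"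
    using \<eta> M y by (auto simp: nat_iso_def iso_def bij_betw_def)
  interpret N: comm_group "fob F N" by (rule additive_functor_group[OF Fa N])
  have "\<eta> N (fmap F M N f x) = \<eta> N \<one>\<^bsub>fob F N\<^esub>"
    using nat_transf_natural[OF \<eta>n M N fh x(1)] k x(2) nat_transf_one[OF Fa G \<eta>n N] by simp
  moreover have "inj_on (\<eta> N) (carrier (fob F N))"
    using \<eta> N by (auto simp: nat_iso_def iso_def bij_betw_def)
  ultimately have "fmap F M N f x = \<one>\<^bsub>fob F N\<^esub>"
    using additive_functor_closed[OF Fa M N fh x(1)] by (auto dest: inj_onD)
  then have "x = \<one>\<^bsub>fob F M\<^esub>" by (rule mono_preservingD[OF F M N f x(1)])
  then show "y = \<one>\<^bsub>fob G M\<^esub>" using x(2) nat_transf_one[OF Fa G \<eta>n M] by simp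
qed


section \<open>The torsion sequence of a functor\<close>

text \<open>
  Naturality of \<open>\<rho>\<close> makes the elements killed by \<open>\<rho>\<close> into a subfunctor, and there \<open>\<rho>\<close> is the
  restriction of that of \<open>F\<close>, hence trivial.
\<close>

lemma inj_stabilization_injectively_stable:
  assumes F: "F \<in> additive_functors R U V" and V: "size_closed V"
  shows "inj_stabilization R U F \<in> injectively_stable_functors R U V"
proof -
  let ?S = "\<lambda>B. {x \<in> carrier (fob F B). rho R U F B x = \<one>\<^bsub>fob F (I0 B)\<^esub>}"
  have eq: "inj_stabilization R U F = \<lparr>fob = (\<lambda>B. (fob F B)\<lparr>carrier := ?S B\<rparr>), fmap = fmap F\<rparr>"
    by (simp add: inj_stabilization_def ker_functor_def kernel_def R0_def Let_def)
  have add: "inj_stabilization R U F \<in> additive_functors R U V"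
    unfolding eq
  proof (rule subfunctor_additive[OF F V])
    show "subgroup (?S M) (fob F M)" if "M \<in> modules_in R U" for M
      using group_hom.subgroup_kernel[OF rho_group_hom[OF F that]] by (simp add: kernel_def)
    fix M N f x
    assume M: "M \<in> modules_in R U" and N: "N \<in> modules_in R U" and f: "f \<in> mod_hom R M N" and x: "x \<in> ?S M"
    have "rho R U F N (fmap F M N f x) = fmap (R0 R U F) M N f \<one>\<^bsub>fob F (I0 M)\<^esub>"
      using rho_natural[OF F M N f, of x] x by simp
    also have "\<dots> = \<one>\<^bsub>fob F (I0 N)\<^esub>"
      using additive_functor_one[OF F I0_in[OF M] I0_in[OF N] inj_lift(1)[OF M N f]] by (simp add: R0_def)
    finally show "fmap F M N f x \<in> ?S N" using additive_functor_closed[OF F M N f] x by simp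
  qed
  show ?thesis
    unfolding injectively_stable_iff[OF add]
    by (simp add: fob_inj_stabilization fmap_inj_stabilization rho_def Let_def)
qed

text \<open>
  The quotient of \<open>F\<close> by its injective stabilization, realised as the image of \<open>\<rho>\<close>. In this form its
  values are subsets of values of \<open>F\<close>, hence of admissible size, and no cosets have to be represented
  by elements of the value type.
\<close>

definition rho_image :: "('r, 'u, 'v) mod_functor \<Rightarrow> ('r, 'u, 'v) mod_functor" where
  "rho_image F =
     \<lparr>fob = (\<lambda>B. (fob F (I0 B))\<lparr>carrier := rho R U F B ` carrier (fob F B)\<rparr>), fmap = fmap (R0 R U F)\<rparr>"

text \<open>
  Every element of the image has the form \<open>\<rho>(x)\<close>, and naturality turns each functor axiom at \<open>\<rho>(x)\<close>
  into the same axiom of \<open>F\<close> at \<open>x\<close>.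
\<close>

lemma rho_image_additive:
  assumes F: "F \<in> additive_functors R U V" and V: "size_closed V"
  shows "rho_image F \<in> additive_functors R U V"
proof -
  let ?Y = "rho_image F"
  have gh: "group_hom (fob F M) (fob F (I0 M)) (rho R U F M)" if "M \<in> modules_in R U" for M
    by (rule rho_group_hom[OF F that])
  have lm: "left_module R M" if "M \<in> modules_in R U" for M using that by (simp add: modules_in_def)
  have nat: "fmap ?Y M N f (rho R U F M x) = rho R U F N (fmap F M N f x)"
    if "M \<in> modules_in R U" "N \<in> modules_in R U" "f \<in> mod_hom R M N" "x \<in> carrier (fob F M)" for M N f x
    using rho_natural[OF F that] by (simp add: rho_image_def)
  have mult: "rho R U F M x \<otimes>\<^bsub>fob F (I0 M)\<^esub> rho R U F M y = rho R U F M (x \<otimes>\<^bsub>fob F M\<^esub> y)"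
    if "M \<in> modules_in R U" "x \<in> carrier (fob F M)" "y \<in> carrier (fob F M)" for M x y
    using group_hom.hom_mult[OF gh[OF that(1)] that(2,3)] by simp
  have groups: "comm_group (fob ?Y M)" if M: "M \<in> modules_in R U" for M
    using comm_group_subgroup[OF additive_functor_group[OF F I0_in[OF M]] group_hom.img_is_subgroup[OF gh[OF M]]]
    by (simp add: rho_image_def)
  have sizes: "carrier (fob ?Y M) \<in> V" if M: "M \<in> modules_in R U" for M
    by (rule size_closedD[OF V additive_functor_size[OF F I0_in[OF M]] subset_imp_lepoll])
      (use group_hom.hom_closed[OF gh[OF M]] in \<open>auto simp: rho_image_def\<close>)
  have homs: "fmap ?Y M N f \<in> hom (fob ?Y M) (fob ?Y N)"
    if M: "M \<in> modules_in R U" and N: "N \<in> modules_in R U" and f: "f \<in> mod_hom R M N" for M N f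
  proof -
    interpret M: comm_group "fob F M" by (rule additive_functor_group[OF F M])
    note cl = additive_functor_closed[OF F M N f]
    have "fmap F M N f (x \<otimes>\<^bsub>fob F M\<^esub> y) = fmap F M N f x \<otimes>\<^bsub>fob F N\<^esub> fmap F M N f y"
      if "x \<in> carrier (fob F M)" "y \<in> carrier (fob F M)" for x y
      using additive_functor_hom[OF F M N f] that by (simp add: hom_def)
    then have "fmap ?Y M N f (rho R U F M x \<otimes>\<^bsub>fob F (I0 M)\<^esub> rho R U F M y)
        = fmap ?Y M N f (rho R U F M x) \<otimes>\<^bsub>fob F (I0 N)\<^esub> fmap ?Y M N f (rho R U F M y)"
      if "x \<in> carrier (fob F M)" "y \<in> carrier (fob F M)" for x y
      using that by (simp add: mult M N cl nat[OF M N f])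
    moreover have "fmap ?Y M N f (rho R U F M x) \<in> rho R U F N ` carrier (fob F N)"
      if "x \<in> carrier (fob F M)" for x
      using nat[OF M N f that] cl[OF that] by simp
    moreover have "carrier (fob ?Y B) = rho R U F B ` carrier (fob F B)" "monoid.mult (fob ?Y B) = monoid.mult (fob F (I0 B))" for B
      by (simp_all add: rho_image_def)
    ultimately show ?thesis by (intro homI) auto
  qed
  have ids: "fmap ?Y M M (\<lambda>m\<in>carrier M. m) y = y" if M: "M \<in> modules_in R U" and y: "y \<in> carrier (fob ?Y M)" for M y
  proof -
    obtain x where x: "x \<in> carrier (fob F M)" "y = rho R U F M x" using y by (auto simp: rho_image_def)
    show ?thesis using x nat[OF M M id_mod_hom[OF lm[OF M]]] additive_functor_id[OF F M] by simp
  qed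
  have comps: "fmap ?Y L N (compose (carrier L) g f) y = fmap ?Y M N g (fmap ?Y L M f y)"
    if L: "L \<in> modules_in R U" and M: "M \<in> modules_in R U" and N: "N \<in> modules_in R U"
      and f: "f \<in> mod_hom R L M" and g: "g \<in> mod_hom R M N" and y: "y \<in> carrier (fob ?Y L)" for L M N f g y
  proof -
    obtain x where x: "x \<in> carrier (fob F L)" "y = rho R U F L x" using y by (auto simp: rho_image_def)
    show ?thesis
      using x nat[OF L N compose_mod_hom[OF lm[OF L] f g]] nat[OF L M f] nat[OF M N g]
        additive_functor_closed[OF F L M f] additive_functor_comp[OF F L M N f g] by simp
  qed
  have sums: "fmap ?Y M N (\<lambda>m\<in>carrier M. f m \<oplus>\<^bsub>N\<^esub> g m) y = fmap ?Y M N f y \<otimes>\<^bsub>fob ?Y N\<^esub> fmap ?Y M N g y"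
    if M: "M \<in> modules_in R U" and N: "N \<in> modules_in R U"
      and f: "f \<in> mod_hom R M N" and g: "g \<in> mod_hom R M N" and y: "y \<in> carrier (fob ?Y M)" for M N f g y
  proof -
    obtain x where x: "x \<in> carrier (fob F M)" "y = rho R U F M x" using y by (auto simp: rho_image_def)
    have "fob ?Y N = (fob F (I0 N))\<lparr>carrier := rho R U F N ` carrier (fob F N)\<rparr>" by (simp add: rho_image_def)
    then show ?thesis
      using x nat[OF M N add_mod_hom[OF lm[OF M] lm[OF N] f g]] nat[OF M N f] nat[OF M N g]
        additive_functor_closed[OF F M N f] additive_functor_closed[OF F M N g]
        additive_functor_add[OF F M N f g] by (simp add: mult[OF N])
  qed
  show ?thesis
    unfolding additive_functors_def mem_Collect_eq
    by (intro conjI ballI groups sizes homs ids comps sums)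
qed

text \<open>
  If the map induced by \<open>f\<close> kills \<open>\<rho>(x)\<close>, then the monomorphism \<open>\<iota> \<circ> f\<close> kills \<open>x\<close>, so that \<open>\<rho>(x)\<close> is trivial by
  independence of the chosen embedding.
\<close>

lemma rho_image_mono_preserving:
  assumes F: "F \<in> additive_functors R U V" and V: "size_closed V"
  shows "rho_image F \<in> mono_preserving_functors R U V"
proof (rule mono_preservingI[OF rho_image_additive[OF F V]])
  fix M N f y
  assume M: "M \<in> modules_in R U" and N: "N \<in> modules_in R U" and f: "f \<in> mod_mono R M N"
    and y: "y \<in> carrier (fob (rho_image F) M)"
    and k: "fmap (rho_image F) M N f y = \<one>\<^bsub>fob (rho_image F) N\<^esub>"
  obtain x where x: "x \<in> carrier (fob F M)" "y = rho R U F M x" using y by (auto simp: rho_image_def)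
  have fh: "f \<in> mod_hom R M N" using f by (simp add: mod_mono_def)
  have "rho R U F N (fmap F M N f x) = \<one>\<^bsub>fob F (I0 N)\<^esub>"
    using rho_natural[OF F M N fh x(1)] k x(2) by (simp add: rho_image_def)
  then have "fmap F M (I0 N) (compose (carrier M) (\<iota> N) f) x = \<one>\<^bsub>fob F (I0 N)\<^esub>"
    using additive_functor_comp[OF F M N I0_in[OF N] fh \<iota>_hom[OF N] x(1)] by (simp add: rho_def Let_def)
  moreover have "compose (carrier M) (\<iota> N) f \<in> mod_mono R M (I0 N)"
    using M by (intro compose_mod_mono[OF _ f \<iota>_mono[OF N]]) (simp add: modules_in_def)
  ultimately show "y = \<one>\<^bsub>fob (rho_image F) M\<^esub>"
    using rho_eq_one_if_killed_by_mono[OF F M I0_in[OF N] _ x(1)] x(2) by (simp add: rho_image_def)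
qed

lemma stabilization_short_exact:
  assumes F: "F \<in> additive_functors R U V" and V: "size_closed V"
  shows "nat_short_exact R U (inj_stabilization R U F) F (rho_image F) (\<lambda>B x. x) (rho R U F)"
  unfolding nat_short_exact_def
proof (intro conjI ballI)
  let ?T = "inj_stabilization R U F" and ?Y = "rho_image F"
  have T: "?T \<in> additive_functors R U V"
    using inj_stabilization_injectively_stable[OF F V] injectively_stable_subset by blast
  have Y: "?Y \<in> additive_functors R U V" by (rule rho_image_additive[OF F V])
  show inc: "(\<lambda>B x. x) \<in> nat_transf R U ?T F"
    by (auto simp: nat_transf_def hom_def fob_inj_stabilization fmap_inj_stabilization)
  show rho: "rho R U F \<in> nat_transf R U F ?Y"
    using rho_hom[OF F] rho_natural[OF F] by (auto simp: nat_transf_def hom_def rho_image_def)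
  fix M assume M: "M \<in> modules_in R U"
  have groups: "group (fob ?T M)" "group (fob F M)" "group (fob ?Y M)"
    using M by (auto intro!: comm_group.axioms(2) additive_functor_group T F Y)
  have "exact_seq ([fob ?Y M, fob F M, fob ?T M], [rho R U F M, \<lambda>x. x])"
    using groups nat_transf_hom[OF inc M] nat_transf_hom[OF rho M]
    by (auto simp: group_hom_def group_hom_axioms_def kernel_def fob_inj_stabilization rho_image_def)
  moreover have "rho R U F M \<in> epi (fob F M) (fob ?Y M)"
    using nat_transf_hom[OF rho M] by (simp add: epi_def rho_image_def)
  moreover have "(\<lambda>x. x) \<in> mon (fob ?T M) (fob F M)"
    using nat_transf_hom[OF inc M] by (simp add: mon_def)
  ultimately show "short_exact_sequence (fob ?Y M) (fob F M) (fob ?T M) (rho R U F M) (\<lambda>x. x)"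
    by (simp only: short_exact_sequence_iff)
qed

end

theorem proposition4p19:
  fixes R :: "('r, 'q) ring_scheme"
    and U :: "'u set set"
    and V :: "'v set set"
  assumes "ring R"
    and "module_universe R U"
    and "size_closed V"
  shows "hereditary_torsion_theory R U V
           (injectively_stable_functors R U V) (mono_preserving_functors R U V)"
proof -
  interpret module_category R U using assms(1,2) by (rule module_category.intro)
  let ?T = "injectively_stable_functors R U V" and ?F = "mono_preserving_functors R U V"
  have "iso_closed R U V ?T"
    unfolding iso_closed_def
  proof (intro ballI impI)
    fix F G assume F: "F \<in> ?T" and G: "G \<in> additive_functors R U V" and "nat_iso R U F G \<noteq> {}"
    then obtain \<eta> where "\<eta> \<in> nat_iso R U F G" by blast
    then show "G \<in> ?T"
      by (intro injectively_stable_quotient[OF F G, of \<eta>]) (auto simp: nat_iso_def iso_def bij_betw_def)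
  qed
  moreover have "iso_closed R U V ?F"
    unfolding iso_closed_def using mono_preserving_iso by blast
  moreover have "\<exists>T\<in>?T. \<exists>Y\<in>?F. \<exists>\<alpha> \<beta>. nat_short_exact R U T X Y \<alpha> \<beta>" if "X \<in> additive_functors R U V" for X
    using inj_stabilization_injectively_stable[OF that assms(3)]
      rho_image_mono_preserving[OF that assms(3)] stabilization_short_exact[OF that assms(3)] by blast
  ultimately have "torsion_theory R U V ?T ?F"
    unfolding torsion_theory_def
    using injectively_stable_subset mono_preserving_subset nat_transf_torsion_torsionfree_zero by blast
  then show ?thesis
    unfolding hereditary_torsion_theory_def using injectively_stable_subobject by blast
qed

end
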